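(* Let $R$ be a commutative ring with identity in which $2$ is invertible, let $r\ge 1$, and let $\omega_a$ ($a\ge 0$) and $u_1,\dots,u_r$ be elements of $R$. Let $W$ be the two strand degenerate cyclotomic BMW algebra over $R$ with these parameters, with generators $s_1,e_1,x_1,x_2$. The following conditions are equivalent: (1) $\{e_1, x_1e_1,\dots,x_1^{r-1}e_1\}$ is linearly independent over $R$. (2) $\{x_1^a e_1 x_1^b,\ x_1^a x_2^b s_1,\ x_1^a x_2^b : 0\le a,b\le r-1\}$ is linearly independent over $R$. (3) The parameters are admissible. (4) The parameters are $u$-admissible.
   Context: The two strand degenerate cyclotomic BMW algebra $W$ over $R$ with parameters $\omega_a$ ($a\ge0$) and $u_1,\dots,u_r$ is the unital associative $R$-algebra with generators $s_1,e_1,x_1,x_2$ and relations: $s_1^2=1$; $e_1^2=\omega_0e_1$; $x_1x_2=x_2x_1$; $s_1x_1-x_2s_1=e_1-1$ and $x_1s_1-s_1x_2=e_1-1$; $e_1x_1^ae_1=\omega_ae_1$ for all $a>0$; $e_1s_1=e_1=s_1e_1$; $e_1(x_1+x_2)=0=(x_1+x_2)e_1$; and $(x_1-u_1)(x_1-u_2)\cdots(x_1-u_r)=0$. Linear independence of the listed elements is linear independence as an indexed family. For $0\le j\le r$ let $a_j=(-1)^{r-j}\varepsilon_{r-j}(u_1,\dots,u_r)$, where $\varepsilon_k$ is the $k$-th elementary symmetric function (so $a_r=1$ and $\prod_{i=1}^r(t-u_i)=\sum_{j=0}^r a_jt^j$). Write $\delta_{(P)}=1$ if $P$ is true and $\delta_{(P)}=0$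 if $P$ is false. The parameters are called admissible if $$\sum_{\mu=0}^{r-j-1}\omega_\mu a_{\mu+j+1}=-2\,\delta_{(r-j\text{ is odd})}\,a_j+\delta_{(j\text{ is even})}\,a_{j+1}\qquad\text{for } 0\le j\le r-1,$$ and $\sum_{\mu=0}^r a_\mu\omega_{\mu+a}=0$ for all $a\ge 0$. The Schur $q$-functions $q_a$ ($a\ge0$) are the symmetric polynomials with integer coefficients in indeterminates $y_1,\dots,y_r$ defined by $\prod_{i=1}^r\frac{1+y_it}{1-y_it}=\sum_{a\ge0}q_a(y_1,\dots,y_r)t^a$. The parameters are called $u$-admissible if $$\omega_a=q_{a+1}(u_1,\dots,u_r)+\tfrac12(-1)^{r-1}q_a(u_1,\dots,u_r)+\tfrac12\delta_{a,0}\qquad\text{for all } a\ge0,$$ where $\delta_{a,0}$ is the Kronecker delta. *)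

theory Defs
  imports
    "HOL-Library.Poly_Mapping"
    "HOL-Computational_Algebra.Formal_Power_Series"
    "HOL-Algebra.QuotRing"
    "HOL-Algebra.Module"
    "HOL-Algebra.Algebraic_Closure_Type"
begin

section \<open>Free associative algebras\<close>

text \<open>
  \<^typ>\<open>'b \<Rightarrow>\<^sub>0 'a\<close> carries the convolution product with respect to addition on \<^typ>\<open>'b\<close>.  Taking for
  \<^typ>\<open>'b\<close> the words over an alphabet, with concatenation written as addition, therefore gives the
  free unital associative algebra on that alphabet.
\<close>

datatype 'g word = Word (letters: "'g list")

instantiation word :: (type) monoid_add
begin

definition zero_word :: "'g word" where
  "zero_word = Word []"

definition plus_word :: "'g word \<Rightarrow> 'g word \<Rightarrow> 'g word" where
  "plus_word v w = Word (letters v @ letters w)"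

instance
  by standard (simp_all add: zero_word_def plus_word_def)

end

type_synonym ('g, 'a) free_alg = "'g word \<Rightarrow>\<^sub>0 'a"

definition scalar :: "'a::comm_ring_1 \<Rightarrow> ('g, 'a) free_alg" where
  "scalar c = Poly_Mapping.single 0 c"

definition gen :: "'g \<Rightarrow> ('g, 'a::comm_ring_1) free_alg" where
  "gen g = Poly_Mapping.single (Word [g]) 1"


section \<open>The two strand degenerate cyclotomic BMW algebra\<close>

datatype dcbmw_gen = S1 | E1 | X1 | X2

text \<open>The set of all differences \<open>lhs - rhs\<close> of the defining relations.\<close>

definition dcbmw_relators ::
  "nat \<Rightarrow> (nat \<Rightarrow> 'a::comm_ring_1) \<Rightarrow> (nat \<Rightarrow> 'a) \<Rightarrow> (dcbmw_gen, 'a) free_alg set" where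
  "dcbmw_relators r \<omega> u =
    (let s = gen S1; e = gen E1; x = gen X1; y = gen X2 in
      {s * s - 1,
       e * e - scalar (\<omega> 0) * e,
       x * y - y * x,
       (s * x - y * s) - (e - 1),
       (x * s - s * y) - (e - 1),
       e * s - e,
       s * e - e,
       e * (x + y),
       (x + y) * e,
       prod_list (map (\<lambda>i. x - scalar (u i)) [1..<Suc r])}
      \<union> {e * x ^ a * e - scalar (\<omega> a) * e | a. a > 0})"

definition dcbmw_ideal ::
  "nat \<Rightarrow> (nat \<Rightarrow> 'a::comm_ring_1) \<Rightarrow> (nat \<Rightarrow> 'a) \<Rightarrow> (dcbmw_gen, 'a) free_alg set" where
  "dcbmw_ideal r \<omega> u = Idl\<^bsub>ring_of_type_algebra\<^esub> (dcbmw_relators r \<omega> u)"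

definition dcbmw_class ::
  "nat \<Rightarrow> (nat \<Rightarrow> 'a::comm_ring_1) \<Rightarrow> (nat \<Rightarrow> 'a)
    \<Rightarrow> (dcbmw_gen, 'a) free_alg \<Rightarrow> (dcbmw_gen, 'a) free_alg set" where
  "dcbmw_class r \<omega> u f = dcbmw_ideal r \<omega> u +>\<^bsub>ring_of_type_algebra\<^esub> f"

definition dcbmw ::
  "nat \<Rightarrow> (nat \<Rightarrow> 'a::comm_ring_1) \<Rightarrow> (nat \<Rightarrow> 'a)
    \<Rightarrow> ('a, (dcbmw_gen, 'a) free_alg set) module" where
  "dcbmw r \<omega> u =
    ring.extend (ring_of_type_algebra Quot dcbmw_ideal r \<omega> u)
      (module.fields (\<lambda>c A. \<Union>f\<in>A. dcbmw_class r \<omega> u (scalar c * f)))"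


lemma ring_of_type_algebra_simps [simp]:
  "carrier (ring_of_type_algebra :: 'b::ring_1 ring) = UNIV"
  "monoid.mult (ring_of_type_algebra :: 'b ring) = (*)"
  "one (ring_of_type_algebra :: 'b ring) = 1"
  "zero (ring_of_type_algebra :: 'b ring) = 0"
  "add (ring_of_type_algebra :: 'b ring) = (+)"
  by (simp_all add: ring_of_type_algebra_def)

lemma ring_ring_of_type_algebra: "ring (ring_of_type_algebra :: 'b::ring_1 ring)"
proof -
  have "\<exists>y. x + y = 0 \<and> y + x = 0" for x :: 'b
    by (rule exI[of _ "- x"]) simp
  then show ?thesis
    by unfold_locales (auto simp: algebra_simps Units_def)
qed

lemma scalar_comm: "scalar c * f = f * scalar c"
  for f :: "('g, 'a::comm_ring_1) free_alg"
proof (induction f rule: update_induct)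
  case const
  show ?case by simp
next
  case (update f a b)
  then have "Poly_Mapping.update a b f = f + Poly_Mapping.single a b"
    by (intro poly_mapping_eqI)
       (auto simp: lookup_update lookup_add lookup_single when_def in_keys_iff)
  with update.IH show ?case
    by (simp add: scalar_def mult_single distrib_left distrib_right mult.commute[of c b])
qed

lemma scalar_ring_hom [simp]:
  "scalar 0 = 0" "scalar 1 = 1"
  "scalar (a + b) = scalar a + scalar b" "scalar (a * b) = scalar a * scalar b"
  by (simp_all add: scalar_def single_add mult_single)

lemma ideal_dcbmw_ideal: "ideal (dcbmw_ideal r \<omega> u) ring_of_type_algebra"
  unfolding dcbmw_ideal_def
  by (rule ring.genideal_ideal) (simp_all add: ring_ring_of_type_algebra)

lemma dcbmw_class_eq_iff: "dcbmw_class r \<omega> u f = dcbmw_class r \<omega> u g \<longleftrightarrow> f - g \<in> dcbmw_ideal r \<omega> u"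
proof -
  interpret ideal "dcbmw_ideal r \<omega> u" ring_of_type_algebra
    by (rule ideal_dcbmw_ideal)
  have "a_inv ring_of_type_algebra g = - g"
    using minus_equality[of "- g" g] by simp
  then have "a_minus ring_of_type_algebra f g = f - g"
    by (simp add: a_minus_def)
  then show ?thesis
    using quotient_eq_iff_same_a_r_cos[OF ideal_dcbmw_ideal, of f g]
    by (simp add: dcbmw_class_def)
qed

lemma dcbmw_simps:
  "carrier (dcbmw r \<omega> u) = range (dcbmw_class r \<omega> u)"
  "\<zero>\<^bsub>dcbmw r \<omega> u\<^esub> = dcbmw_class r \<omega> u 0"
  "\<one>\<^bsub>dcbmw r \<omega> u\<^esub> = dcbmw_class r \<omega> u 1"
  "dcbmw_class r \<omega> u f \<oplus>\<^bsub>dcbmw r \<omega> u\<^esub> dcbmw_class r \<omega> u g = dcbmw_class r \<omega> u (f + g)"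
  "dcbmw_class r \<omega> u f \<otimes>\<^bsub>dcbmw r \<omega> u\<^esub> dcbmw_class r \<omega> u g = dcbmw_class r \<omega> u (f * g)"
  "c \<odot>\<^bsub>dcbmw r \<omega> u\<^esub> dcbmw_class r \<omega> u f = dcbmw_class r \<omega> u (scalar c * f)"
proof -
  interpret ideal "dcbmw_ideal r \<omega> u" ring_of_type_algebra
    by (rule ideal_dcbmw_ideal)
  note defs = dcbmw_def ring.defs module.defs FactRing_def dcbmw_class_def
  show "carrier (dcbmw r \<omega> u) = range (dcbmw_class r \<omega> u)"
    by (auto simp: defs A_RCOSETS_def')
  show "\<zero>\<^bsub>dcbmw r \<omega> u\<^esub> = dcbmw_class r \<omega> u 0"
    by (simp add: defs a_r_coset_def')
  show "\<one>\<^bsub>dcbmw r \<omega> u\<^esub> = dcbmw_class r \<omega> u 1"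
    by (simp add: defs)
  show "dcbmw_class r \<omega> u f \<oplus>\<^bsub>dcbmw r \<omega> u\<^esub> dcbmw_class r \<omega> u g = dcbmw_class r \<omega> u (f + g)"
    using a_rcos_sum[of f g] by (simp add: defs)
  show "dcbmw_class r \<omega> u f \<otimes>\<^bsub>dcbmw r \<omega> u\<^esub> dcbmw_class r \<omega> u g = dcbmw_class r \<omega> u (f * g)"
    using rcoset_mult_add[of f g] by (simp add: defs)
  have "dcbmw_class r \<omega> u (scalar c * g) = dcbmw_class r \<omega> u (scalar c * f)"
    if "g \<in> dcbmw_class r \<omega> u f" for g
  proof -
    obtain h where h: "h \<in> dcbmw_ideal r \<omega> u" "g = h + f"
      using \<open>g \<in> _\<close> by (auto simp: dcbmw_class_def a_r_coset_def')
    have "scalar c * g - scalar c * f = scalar c * h"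
      by (simp add: h algebra_simps)
    then show ?thesis
      using I_l_closed[OF h(1), of "scalar c"] by (simp add: dcbmw_class_eq_iff)
  qed
  then have "(\<Union>g\<in>dcbmw_class r \<omega> u f. dcbmw_class r \<omega> u (scalar c * g)) =
      (\<Union>g\<in>dcbmw_class r \<omega> u f. dcbmw_class r \<omega> u (scalar c * f))"
    by (rule SUP_cong[OF refl])
  also have "f \<in> dcbmw_class r \<omega> u f"
    using a_rcos_self[of f] by (simp add: dcbmw_class_def)
  then have "(\<Union>g\<in>dcbmw_class r \<omega> u f. dcbmw_class r \<omega> u (scalar c * f)) = dcbmw_class r \<omega> u (scalar c * f)"
    by blast
  finally show "c \<odot>\<^bsub>dcbmw r \<omega> u\<^esub> dcbmw_class r \<omega> u f = dcbmw_class r \<omega> u (scalar c * f)"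
    by (simp add: dcbmw_def ring.defs module.defs)
qed

lemma ring_dcbmw: "ring (dcbmw r \<omega> u)"
proof (intro ringI abelian_groupI monoidI)
  show "\<exists>y\<in>carrier (dcbmw r \<omega> u). y \<oplus>\<^bsub>dcbmw r \<omega> u\<^esub> x = \<zero>\<^bsub>dcbmw r \<omega> u\<^esub>"
    if "x \<in> carrier (dcbmw r \<omega> u)" for x
  proof -
    obtain f where "x = dcbmw_class r \<omega> u f" using \<open>x \<in> _\<close> by (auto simp: dcbmw_simps)
    then show ?thesis
      by (intro bexI[of _ "dcbmw_class r \<omega> u (- f)"]) (simp_all add: dcbmw_simps)
  qed
qed (auto simp: dcbmw_simps algebra_simps)

lemma module_dcbmw: "module ring_of_type_algebra (dcbmw r \<omega> u)"
proof (intro moduleI)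
  show "cring (ring_of_type_algebra :: 'a ring)" by (rule cring_from_type_algebra)
  show "abelian_group (dcbmw r \<omega> u)" using ring_dcbmw by (rule ring.is_abelian_group)
qed (auto simp: dcbmw_simps algebra_simps)

lemma smult_dcbmw:
  assumes "x \<in> carrier (dcbmw r \<omega> u)" "y \<in> carrier (dcbmw r \<omega> u)"
  shows "(c \<odot>\<^bsub>dcbmw r \<omega> u\<^esub> x) \<otimes>\<^bsub>dcbmw r \<omega> u\<^esub> y = c \<odot>\<^bsub>dcbmw r \<omega> u\<^esub> (x \<otimes>\<^bsub>dcbmw r \<omega> u\<^esub> y)"
    and "x \<otimes>\<^bsub>dcbmw r \<omega> u\<^esub> (c \<odot>\<^bsub>dcbmw r \<omega> u\<^esub> y) = c \<odot>\<^bsub>dcbmw r \<omega> u\<^esub> (x \<otimes>\<^bsub>dcbmw r \<omega> u\<^esub> y)"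
  using assms by (auto simp: dcbmw_simps mult.assoc scalar_comm)


section \<open>Linear independence of an indexed family\<close>

definition lin_indep_family ::
  "('a, 'm) ring_scheme \<Rightarrow> ('a, 'b, 'n) module_scheme \<Rightarrow> ('i \<Rightarrow> 'b) \<Rightarrow> 'i set \<Rightarrow> bool" where
  "lin_indep_family R M v J \<longleftrightarrow>
    (\<forall>K c. finite K \<longrightarrow> K \<subseteq> J \<longrightarrow> c \<in> K \<rightarrow> carrier R \<longrightarrow>
      finsum M (\<lambda>i. c i \<odot>\<^bsub>M\<^esub> v i) K = \<zero>\<^bsub>M\<^esub> \<longrightarrow> (\<forall>i\<in>K. c i = \<zero>\<^bsub>R\<^esub>))"


section \<open>Admissibility\<close>

definition elem_sym :: "nat \<Rightarrow> (nat \<Rightarrow> 'a::comm_ring_1) \<Rightarrow> nat \<Rightarrow> 'a" where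
  "elem_sym r u k = (\<Sum>S | S \<subseteq> {1..r} \<and> card S = k. \<Prod>i\<in>S. u i)"

definition adm_coeff :: "nat \<Rightarrow> (nat \<Rightarrow> 'a::comm_ring_1) \<Rightarrow> nat \<Rightarrow> 'a" where
  "adm_coeff r u j = (-1) ^ (r - j) * elem_sym r u (r - j)"

definition admissible :: "nat \<Rightarrow> (nat \<Rightarrow> 'a::comm_ring_1) \<Rightarrow> (nat \<Rightarrow> 'a) \<Rightarrow> bool" where
  "admissible r \<omega> u \<longleftrightarrow>
    (\<forall>j \<in> {0..r - 1}.
      (\<Sum>\<mu> = 0..r - j - 1. \<omega> \<mu> * adm_coeff r u (\<mu> + j + 1))
        = - 2 * of_bool (odd (r - j)) * adm_coeff r u j
          + of_bool (even j) * adm_coeff r u (j + 1)) \<and>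
    (\<forall>a. (\<Sum>\<mu> = 0..r. adm_coeff r u \<mu> * \<omega> (\<mu> + a)) = 0)"

text \<open>
  The value at \<open>(u 1, \<dots>, u r)\<close> of the Schur \<open>q\<close>-function: its generating function is evaluated
  coefficientwise, with \<open>1 / (1 - u i t)\<close> written as the geometric series.
\<close>

definition schur_q_gf :: "nat \<Rightarrow> (nat \<Rightarrow> 'a::comm_ring_1) \<Rightarrow> 'a fps" where
  "schur_q_gf r u = (\<Prod>i = 1..r. (1 + fps_const (u i) * fps_X) * Abs_fps (\<lambda>n. u i ^ n))"

definition schur_q :: "nat \<Rightarrow> (nat \<Rightarrow> 'a::comm_ring_1) \<Rightarrow> nat \<Rightarrow> 'a" where
  "schur_q r u a = fps_nth (schur_q_gf r u) a"

lemma geometric_fps: "(1 - fps_const c * fps_X) * Abs_fps (\<lambda>n. c ^ n) = (1 :: 'a::comm_ring_1 fps)"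
proof (rule fps_ext)
  fix n
  show "fps_nth ((1 - fps_const c * fps_X) * Abs_fps (\<lambda>n. c ^ n)) n = fps_nth 1 n"
    by (cases n) (simp_all add: left_diff_distrib mult.assoc)
qed

lemma schur_q_gf_eq:
  "schur_q_gf r u * (\<Prod>i = 1..r. 1 - fps_const (u i) * fps_X) = (\<Prod>i = 1..r. 1 + fps_const (u i) * fps_X)"
proof -
  have "schur_q_gf r u * (\<Prod>i = 1..r. 1 - fps_const (u i) * fps_X) =
      (\<Prod>i = 1..r. (1 + fps_const (u i) * fps_X) * ((1 - fps_const (u i) * fps_X) * Abs_fps (\<lambda>n. u i ^ n)))"
    unfolding schur_q_gf_def prod.distrib [symmetric] by (simp only: mult_ac)
  then show ?thesis by (simp only: geometric_fps mult_1_right)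
qed

text \<open>Meaningful only if \<open>2\<close> is invertible.\<close>

definition half :: "'a::comm_ring_1" where
  "half = (THE h. 2 * h = 1)"

lemma two_mult_half:
  assumes "(2::'a::comm_ring_1) dvd 1"
  shows "2 * half = (1::'a)"
proof -
  obtain h :: 'a where h: "2 * h = 1"
    using assms by (metis dvdE)
  have "k = h" if "2 * k = 1" for k :: 'a
  proof -
    have "k = (2 * h) * k" by (simp add: h)
    also have "\<dots> = h * (2 * k)" by (simp only: mult_ac)
    finally show ?thesis using that by simp
  qed
  then show ?thesis
    unfolding half_def using h by (rule theI[where P = "\<lambda>h. 2 * h = 1", rotated])
qed

definition u_admissible :: "nat \<Rightarrow> (nat \<Rightarrow> 'a::comm_ring_1) \<Rightarrow> (nat \<Rightarrow> 'a) \<Rightarrow> bool" where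
  "u_admissible r \<omega> u \<longleftrightarrow>
    (\<forall>a. \<omega> a = schur_q r u (a + 1) + half * (-1) ^ (r - 1) * schur_q r u a
           + half * of_bool (a = 0))"

end

(*
  (1) ==> (3): commuting s1 past a polynomial in x1 gives s1 P(x1) e1 = (sigma P)(x1) e1 for an explicit
  linear map sigma on polynomials.  For p = prod (t - u_i), comparing s1 p(x1) e1 = 0 with
  p(x1) e1 = 0 forces sigma p = (-1)^r p, and e1 x1^a p(x1) e1 = 0 forces omega(t^a p) = 0; written in
  coefficients these are the admissibility equations.

  (3) <=> (4): both say that the generating function of the omega_a, multiplied by prod (1 - u_i t), is a
  prescribed polynomial.  Since the q-series Q satisfies Q(t) Q(-t) = 1, u-admissibility also yields
  the quadratic relations omega(sigma P) = omega(P).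

  (3) ==> (2): the quadratic relations alone make the free module on all x1^a e1 x1^b, x1^a x2^b s1,
  x1^a x2^b (a, b >= 0) a module over the algebra without the relation p(x1) = 0.  It also carries
  right multiplications by s1 and x1 that commute with the left action, so the two-sided ideal generated
  by p(x1) is easy to describe; division by the monic polynomials p(y) and p(y) +- D shows that it
  contains no nonzero element with all exponents < r.

  (2) ==> (1): the first family is part of the second.
*)
theory Submission
  imports Defs
begin

section \<open>Linear extension\<close>

text \<open>Since R may have zero divisors, there is no passage to a field; polynomials are
  cancelled only when monic. A module for the quotient by p(x1) would require every relation to be
  checked modulo p. Here exponents are unbounded instead, so that relations are identities between
  operators on basis vectors, and p enters only through the submodule \<open>cyc_ideal\<close>. The
  vector \<open>U 0 0\<close> plays the part of 1: each listed product sends it to its own basis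
  vector, so a dependence in W becomes an element of \<open>cyc_ideal\<close> with small exponents.

  The quadratic relations express associativity of e1 s1 x1^a e1: rewriting s1 x1^a e1 gives
  omega(sigma t^a), rewriting e1 s1 = e1 gives omega(t^a). Invertibility of 2 serves u-admissibility
  and also separates the terms x1^a x2^b s1 from x1^a x2^b, which right multiplication by s1
  exchanges.\<close>

definition pm_scale :: "'a::comm_ring_1 \<Rightarrow> ('k \<Rightarrow>\<^sub>0 'a) \<Rightarrow> ('k \<Rightarrow>\<^sub>0 'a)" where
  "pm_scale c m = Poly_Mapping.map ((*) c) m"

definition bas :: "'k \<Rightarrow> ('k \<Rightarrow>\<^sub>0 'a::comm_ring_1)" where
  "bas k = Poly_Mapping.single k 1"

lemma lookup_pm_scale [simp]: "Poly_Mapping.lookup (pm_scale c m) k = c * Poly_Mapping.lookup m k"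
  by (auto simp: pm_scale_def Poly_Mapping.map.rep_eq when_def)

text \<open>
  Extending \<^locale>\<open>Modules.module\<close> itself would let its interpretation \<open>real_vector?\<close>, whose qualifier
  is optional, capture the unqualified names introduced below.
\<close>

locale lmod = Modules.module scale
  for scale :: "'a::comm_ring_1 \<Rightarrow> 'b::ab_group_add \<Rightarrow> 'b" (infixr \<open>*s\<close> 75)

locale lhom = m1: lmod s1 + m2: lmod s2 + Modules.module_hom s1 s2 f
  for s1 :: "'a::comm_ring_1 \<Rightarrow> 'b::ab_group_add \<Rightarrow> 'b"
    and s2 :: "'a \<Rightarrow> 'c::ab_group_add \<Rightarrow> 'c" and f :: "'b \<Rightarrow> 'c"

interpretation pm: lmod pm_scale
  by unfold_locales (auto intro!: poly_mapping_eqI simp: lookup_add algebra_simps)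

interpretation mulmod: lmod "(*) :: 'a::comm_ring_1 \<Rightarrow> 'a \<Rightarrow> 'a"
  by unfold_locales (auto simp: algebra_simps)

text \<open>As a rewrite rule this is reassociation to the left, which loops together with \<open>ac_simps\<close>.\<close>

declare mulmod.scale_scale [simp del]

interpretation smultmod: lmod "smult :: 'a::comm_ring_1 \<Rightarrow> 'a poly \<Rightarrow> 'a poly"
  by unfold_locales (auto simp: smult_add_right smult_add_left)

lemma single_eq_scale: "Poly_Mapping.single k c = pm_scale c (bas k)"
  by (rule poly_mapping_eqI) (auto simp: bas_def lookup_single when_def)

text \<open>Linear operators on the free module agree once they agree on basis vectors; most
  operator identities below are proved in this way.\<close>

lemma pm_induct [case_names bas add scale]:
  assumes "\<And>k. P (bas k)" "\<And>m n. P m \<Longrightarrow> P n \<Longrightarrow> P (m + n)" "\<And>c m. P m \<Longrightarrow> P (pm_scale c m)"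
  shows "P (m :: 'k \<Rightarrow>\<^sub>0 'a::comm_ring_1)"
proof (induction m rule: update_induct)
  case const
  show ?case using assms(3)[OF assms(1), of 0] by simp
next
  case (update f a b)
  then have "Poly_Mapping.update a b f = f + Poly_Mapping.single a b"
    by (intro poly_mapping_eqI)
       (auto simp: lookup_update lookup_add lookup_single when_def in_keys_iff)
  with update.IH assms show ?case
    by (simp add: single_eq_scale)
qed

context lmod
begin

definition lext :: "('k \<Rightarrow> 'b) \<Rightarrow> ('k \<Rightarrow>\<^sub>0 'a) \<Rightarrow> 'b" where
  "lext f m = (\<Sum>k\<in>Poly_Mapping.keys m. Poly_Mapping.lookup m k *s f k)"

definition plin :: "(nat \<Rightarrow> 'b) \<Rightarrow> 'a poly \<Rightarrow> 'b" where
  "plin f P = (\<Sum>i\<le>degree P. coeff P i *s f i)"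

lemma lext_superset:
  fixes m :: "'k \<Rightarrow>\<^sub>0 'a"
  assumes "finite A" "Poly_Mapping.keys m \<subseteq> A"
  shows "lext f m = (\<Sum>k\<in>A. Poly_Mapping.lookup m k *s f k)"
  unfolding lext_def by (rule sum.mono_neutral_left) (use assms in \<open>auto simp: in_keys_iff\<close>)

lemma plin_superset:
  fixes P :: "'a poly"
  assumes "degree P \<le> n"
  shows "plin f P = (\<Sum>i\<le>n. coeff P i *s f i)"
  unfolding plin_def
  by (rule sum.mono_neutral_left) (use assms in \<open>auto simp: coeff_eq_0\<close>)

lemma hom_lext: "lhom pm_scale scale (lext f)"
proof unfold_locales
  show "lext f (m + n) = lext f m + lext f n" for m n
  proof -
    let ?A = "Poly_Mapping.keys m \<union> Poly_Mapping.keys n"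
    show ?thesis
      by (subst (1 2 3) lext_superset[where A = ?A])
         (use Poly_Mapping.keys_add[of m n] in
           \<open>auto simp: lookup_add scale_left_distrib sum.distrib\<close>)
  qed
  show "lext f (pm_scale c m) = c *s lext f m" for c m
    by (subst (1 2) lext_superset[where A = "Poly_Mapping.keys m"])
       (auto simp: in_keys_iff scale_sum_right)
qed

lemma lext_bas [simp]: "lext f (bas k) = f k"
  by (simp add: lext_def bas_def)

lemma hom_plin: "lhom smult scale (plin f)"
proof unfold_locales
  show "plin f (P + Q) = plin f P + plin f Q" for P Q
    by (subst (1 2 3) plin_superset[where n = "max (degree P) (degree Q)"])
       (auto simp: degree_add_le_max scale_left_distrib sum.distrib)
  show "plin f (smult c P) = c *s plin f P" for c P
    by (subst (1 2) plin_superset[where n = "degree P"]) (auto simp: scale_sum_right degree_smult_le)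
qed

lemma plin_monom: "plin f (monom c i) = c *s f i"
proof -
  have "plin f (monom c i) = (\<Sum>j\<le>i. coeff (monom c i) j *s f j)"
    by (rule plin_superset) (rule degree_monom_le)
  also have "\<dots> = (\<Sum>j\<in>{i}. coeff (monom c i) j *s f j)"
    by (rule sum.mono_neutral_right) auto
  finally show ?thesis by simp
qed

text \<open>Both sides are the same double sum. It is the reason why left and right multiplication
  by s1 commute on x1^a e1 x1^b.\<close>

lemma plin_swap: "plin (\<lambda>i. plin (\<lambda>j. f i j) P) Q = plin (\<lambda>j. plin (\<lambda>i. f i j) Q) P"
  unfolding plin_def scale_sum_right by (subst sum.swap) (simp add: mult.commute)

sublocale plin: lhom smult scale "plin f" for f
  by (rule hom_plin)

sublocale lext: lhom pm_scale scale "lext f" for f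
  by (rule hom_lext)

end

context lhom
begin

lemma plin: "f (m1.plin g P) = m2.plin (\<lambda>i. f (g i)) P"
  by (simp add: m1.plin_def m2.plin_def sum scale)

end

lemma poly_lin_induct [case_names monom add scale]:
  assumes "\<And>i. P (monom 1 i)" "\<And>m n. P m \<Longrightarrow> P n \<Longrightarrow> P (m + n)" "\<And>c m. P m \<Longrightarrow> P (smult c m)"
  shows "P (m :: 'a::comm_ring_1 poly)"
proof -
  have "P (\<Sum>i\<in>A. smult (coeff m i) (monom 1 i))" if "finite A" for A
    using that by (induction A) (use assms assms(3)[OF assms(1), of 0] in auto)
  from this[of "{..degree m}"] show ?thesis
    by (simp add: smult_monom poly_as_sum_of_monoms)
qed

lemma lhom_funpow:
  assumes "lhom s s F" shows "lhom s s (F ^^ k)"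
proof -
  interpret lhom s s F by fact
  show ?thesis by unfold_locales (induction k; simp add: add scale)+
qed

section \<open>The module for the algebra without the cyclotomic relation\<close>

text \<open>
  \<open>sig \<omega> a\<close> is the polynomial \<open>Q\<close> with \<open>s\<^sub>1 x\<^sub>1\<^sup>a e\<^sub>1 = Q(x\<^sub>1) e\<^sub>1\<close>; the recursion comes from
  \<open>s\<^sub>1 x\<^sub>1 = x\<^sub>2 s\<^sub>1 + e\<^sub>1 - 1\<close> and \<open>x\<^sub>2 e\<^sub>1 = - x\<^sub>1 e\<^sub>1\<close>.
\<close>

context
  fixes \<omega> :: "nat \<Rightarrow> 'a::comm_ring_1"
begin

primrec sig :: "nat \<Rightarrow> 'a poly" where
  "sig 0 = 1"
| "sig (Suc a) = [:\<omega> a:] - monom 1 a - monom 1 1 * sig a"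

definition sigma :: "'a poly \<Rightarrow> 'a poly" where
  "sigma P = smultmod.plin sig P"

definition omega :: "'a poly \<Rightarrow> 'a" where
  "omega P = mulmod.plin \<omega> P"

end

global_interpretation sigma: lhom smult smult "sigma \<omega>" for \<omega>
  unfolding sigma_def by (rule smultmod.hom_plin)

global_interpretation omega: lhom smult "(*)" "omega \<omega>" for \<omega>
  unfolding omega_def by (rule mulmod.hom_plin)

lemma sigma_monom: "sigma \<omega> (monom c a) = smult c (sig \<omega> a)"
  by (simp add: sigma_def smultmod.plin_monom)

lemma omega_monom: "omega \<omega> (monom c a) = c * \<omega> a"
  by (simp add: omega_def mulmod.plin_monom)

lemma sigma_1 [simp]: "sigma \<omega> 1 = 1"
  using sigma_monom[of \<omega> 1 0] by (simp add: monom_0 one_pCons)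

text \<open>The recursion for \<open>sig\<close>, extended linearly: s1 x1 P(x1) e1 = x2 s1 P(x1) e1
  + e1 P(x1) e1 - P(x1) e1, and x2 acts as -x1 on multiples f(x1) e1.\<close>

lemma sigma_x: "sigma \<omega> (monom 1 1 * P) = [:omega \<omega> P:] - P - monom 1 1 * sigma \<omega> P"
  by (induction P rule: poly_lin_induct)
     (simp_all add: mult_monom sigma_monom omega_monom distrib_left sigma.add sigma.scale
       omega.add omega.scale smult_diff_right)

text \<open>
  \<open>E3 a b\<close>, \<open>T a b\<close> and \<open>U a b\<close> stand for \<open>x\<^sub>1\<^sup>a e\<^sub>1 x\<^sub>1\<^sup>b\<close>, \<open>x\<^sub>1\<^sup>a x\<^sub>2\<^sup>b s\<^sub>1\<close> and \<open>x\<^sub>1\<^sup>a x\<^sub>2\<^sup>b\<close>.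
\<close>

datatype idx = E3 nat nat | T nat nat | U nat nat

context
  fixes \<omega> :: "nat \<Rightarrow> 'a::comm_ring_1"
begin

definition L1 :: "nat \<Rightarrow> 'a poly \<Rightarrow> (idx \<Rightarrow>\<^sub>0 'a)" where
  "L1 b P = pm.plin (\<lambda>i. bas (E3 i b)) P"

definition L2 :: "nat \<Rightarrow> 'a poly \<Rightarrow> (idx \<Rightarrow>\<^sub>0 'a)" where
  "L2 a P = pm.plin (\<lambda>j. bas (E3 a j)) P"

text \<open>
  \<open>L1 b P\<close> is \<open>P(x\<^sub>1) e\<^sub>1 x\<^sub>1\<^sup>b\<close> and \<open>L2 a P\<close> is \<open>x\<^sub>1\<^sup>a e\<^sub>1 P(x\<^sub>1)\<close>.  The operators \<open>opX\<close>, \<open>opY\<close>, \<open>opE\<close>, \<open>opS\<close> are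
  left multiplication by \<open>x\<^sub>1\<close>, \<open>x\<^sub>2\<close>, \<open>e\<^sub>1\<close>, \<open>s\<^sub>1\<close>, while \<open>opRs\<close> and \<open>opRx\<close> are right multiplication by
  \<open>s\<^sub>1\<close> and \<open>x\<^sub>1\<close>.
\<close>

definition opX :: "(idx \<Rightarrow>\<^sub>0 'a) \<Rightarrow> (idx \<Rightarrow>\<^sub>0 'a)" where
  "opX = pm.lext (case_idx (\<lambda>a b. bas (E3 (Suc a) b)) (\<lambda>a b. bas (T (Suc a) b)) (\<lambda>a b. bas (U (Suc a) b)))"

definition opY :: "(idx \<Rightarrow>\<^sub>0 'a) \<Rightarrow> (idx \<Rightarrow>\<^sub>0 'a)" where
  "opY = pm.lext (case_idx (\<lambda>a b. - bas (E3 (Suc a) b)) (\<lambda>a b. bas (T a (Suc b))) (\<lambda>a b. bas (U a (Suc b))))"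

definition opE :: "(idx \<Rightarrow>\<^sub>0 'a) \<Rightarrow> (idx \<Rightarrow>\<^sub>0 'a)" where
  "opE = pm.lext (case_idx
    (\<lambda>a b. pm_scale (\<omega> a) (bas (E3 0 b)))
    (\<lambda>a b. pm_scale ((-1) ^ b) (L2 0 (sig \<omega> (a + b))))
    (\<lambda>a b. pm_scale ((-1) ^ b) (bas (E3 0 (a + b)))))"

definition opRs :: "(idx \<Rightarrow>\<^sub>0 'a) \<Rightarrow> (idx \<Rightarrow>\<^sub>0 'a)" where
  "opRs = pm.lext (case_idx (\<lambda>a b. L2 a (sig \<omega> b)) (\<lambda>a b. bas (U a b)) (\<lambda>a b. bas (T a b)))"

definition opRx :: "(idx \<Rightarrow>\<^sub>0 'a) \<Rightarrow> (idx \<Rightarrow>\<^sub>0 'a)" where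
  "opRx = pm.lext (case_idx (\<lambda>a b. bas (E3 a (Suc b)))
    (\<lambda>a b. bas (T a (Suc b)) + pm_scale ((-1) ^ b) (bas (E3 (a + b) 0)) - bas (U a b))
    (\<lambda>a b. bas (U (Suc a) b)))"

text \<open>The normal form of s1 x1^a x2^b. Powers of x1 are moved past s1 before powers of
  x2.\<close>

fun SU :: "nat \<Rightarrow> nat \<Rightarrow> (idx \<Rightarrow>\<^sub>0 'a)" where
  "SU 0 0 = bas (T 0 0)"
| "SU 0 (Suc b) = opX (SU 0 b) - opE (bas (U 0 b)) + bas (U 0 b)"
| "SU (Suc a) b = opY (SU a b) + opE (bas (U a b)) - bas (U a b)"

text \<open>On \<open>T a b\<close> the product is bracketed as (s1 x1^a x2^b) s1, which reduces it
  to the case of \<open>U\<close>.\<close>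

definition opS :: "(idx \<Rightarrow>\<^sub>0 'a) \<Rightarrow> (idx \<Rightarrow>\<^sub>0 'a)" where
  "opS = pm.lext (case_idx (\<lambda>a b. L1 b (sig \<omega> a)) (\<lambda>a b. opRs (SU a b)) SU)"

end

global_interpretation L1: lhom smult pm_scale "L1 b" for b
  unfolding L1_def by (rule pm.hom_plin)
global_interpretation L2: lhom smult pm_scale "L2 a" for a
  unfolding L2_def by (rule pm.hom_plin)
global_interpretation X: lhom pm_scale pm_scale opX
  unfolding opX_def by (rule pm.hom_lext)
global_interpretation Y: lhom pm_scale pm_scale opY
  unfolding opY_def by (rule pm.hom_lext)
global_interpretation E: lhom pm_scale pm_scale "opE \<omega>" for \<omega>
  unfolding opE_def by (rule pm.hom_lext)
global_interpretation Rs: lhom pm_scale pm_scale "opRs \<omega>" for \<omega>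
  unfolding opRs_def by (rule pm.hom_lext)
global_interpretation Rx: lhom pm_scale pm_scale opRx
  unfolding opRx_def by (rule pm.hom_lext)
global_interpretation S: lhom pm_scale pm_scale "opS \<omega>" for \<omega>
  unfolding opS_def by (rule pm.hom_lext)

lemmas op_linear =
  L1.add L1.scale L1.diff L1.neg
  L2.add L2.scale L2.diff L2.neg
  X.add X.scale X.diff X.neg
  Y.add Y.scale Y.diff Y.neg
  E.add E.scale E.diff E.neg
  Rs.add Rs.scale Rs.diff Rs.neg
  Rx.add Rx.scale Rx.diff Rx.neg
  S.add S.scale S.diff S.neg
  pm.scale_right_distrib pm.scale_right_diff_distrib

lemma op_bas [simp]:
  "opX (bas (E3 a b)) = bas (E3 (Suc a) b)"
  "opX (bas (T a b)) = bas (T (Suc a) b)"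
  "opX (bas (U a b)) = bas (U (Suc a) b)"
  "opY (bas (E3 a b)) = - bas (E3 (Suc a) b)"
  "opY (bas (T a b)) = bas (T a (Suc b))"
  "opY (bas (U a b)) = bas (U a (Suc b))"
  "opE \<omega> (bas (E3 a b)) = pm_scale (\<omega> a) (bas (E3 0 b))"
  "opE \<omega> (bas (T a b)) = pm_scale ((-1) ^ b) (L2 0 (sig \<omega> (a + b)))"
  "opE \<omega> (bas (U a b)) = pm_scale ((-1) ^ b) (bas (E3 0 (a + b)))"
  "opRs \<omega> (bas (E3 a b)) = L2 a (sig \<omega> b)"
  "opRs \<omega> (bas (T a b)) = bas (U a b)"
  "opRs \<omega> (bas (U a b)) = bas (T a b)"
  "opRx (bas (E3 a b)) = bas (E3 a (Suc b))"
  "opRx (bas (T a b)) = bas (T a (Suc b)) + pm_scale ((-1) ^ b) (bas (E3 (a + b) 0)) - bas (U a b)"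
  "opRx (bas (U a b)) = bas (U (Suc a) b)"
  "opS \<omega> (bas (E3 a b)) = L1 b (sig \<omega> a)"
  "opS \<omega> (bas (T a b)) = opRs \<omega> (SU \<omega> a b)"
  "opS \<omega> (bas (U a b)) = SU \<omega> a b"
  by (simp_all add: opX_def opY_def opE_def opRs_def opRx_def opS_def)

lemma L_monom:
  "L1 b (monom c i) = pm_scale c (bas (E3 i b))"
  "L2 a (monom c i) = pm_scale c (bas (E3 a i))"
  by (simp_all add: L1_def L2_def pm.plin_monom)

lemma L_const:
  "L1 b [:c:] = pm_scale c (bas (E3 0 b))" "L2 a [:c:] = pm_scale c (bas (E3 a 0))"
  using L_monom[of _ c 0] by (simp_all add: monom_0)

lemma L_1 [simp]: "L1 b 1 = bas (E3 0 b)" "L2 a 1 = bas (E3 a 0)"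
  by (simp_all only: one_pCons L_const pm.scale_one)

lemma op_L:
  "opX (L1 b P) = L1 b (monom 1 1 * P)"
  "opX (L2 a P) = L2 (Suc a) P"
  "opY (L1 b P) = - L1 b (monom 1 1 * P)"
  "opY (L2 a P) = - L2 (Suc a) P"
  "opE \<omega> (L1 b P) = pm_scale (omega \<omega> P) (bas (E3 0 b))"
  "opE \<omega> (L2 a P) = pm_scale (\<omega> a) (L2 0 P)"
  "opRs \<omega> (L2 a P) = L2 a (sigma \<omega> P)"
  "opRx (L1 b P) = L1 (Suc b) P"
  "opRx (L2 a P) = L2 a (monom 1 1 * P)"
  "opS \<omega> (L1 b P) = L1 b (sigma \<omega> P)"
  by (induction P rule: poly_lin_induct)
     (simp_all add: op_linear L_monom mult_monom distrib_left distrib_right sigma_monom omega_monom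
       omega.add omega.scale sigma.add sigma.scale pm.scale_left_distrib mult.commute)

lemma XY: "opX (opY m) = opY (opX m)"
proof (induction m rule: pm_induct)
  case (bas k) then show ?case by (cases k) (simp_all add: op_linear)
qed (simp_all add: op_linear)

lemma YE: "opY (opE \<omega> m) = - opX (opE \<omega> m)"
proof (induction m rule: pm_induct)
  case (bas k) then show ?case by (cases k) (simp_all add: op_linear op_L)
qed (simp_all add: op_linear)

lemma EY: "opE \<omega> (opY m) = - opE \<omega> (opX m)"
proof (induction m rule: pm_induct)
  case (bas k) then show ?case by (cases k) (simp_all add: op_linear op_L)
qed (simp_all add: op_linear)

global_interpretation Xk: lhom pm_scale pm_scale "opX ^^ k" for k
  by (rule lhom_funpow) (rule X.lhom_axioms)

lemma Xk_E3: "(opX ^^ k) (bas (E3 a b)) = bas (E3 (k + a) b)"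
  by (induction k) simp_all

lemma Xk_L2: "(opX ^^ k) (L2 a P) = L2 (k + a) P"
  by (induction k) (simp_all add: op_L)

lemma Xk_U: "(opX ^^ k) (bas (U a b)) = bas (U (k + a) b)"
  by (induction k) simp_all

lemma Xk_T: "(opX ^^ k) (bas (T a b)) = bas (T (k + a) b)"
  by (induction k) simp_all

lemma EXE: "opE \<omega> ((opX ^^ k) (opE \<omega> m)) = pm_scale (\<omega> k) (opE \<omega> m)"
proof (induction m rule: pm_induct)
  case (bas j) then show ?case
    by (cases j) (simp_all add: op_linear op_L Xk.scale Xk_L2 Xk_E3 mult.commute)
qed (simp_all add: op_linear Xk.add Xk.scale mult.commute)

lemma Rs_X: "opRs \<omega> (opX m) = opX (opRs \<omega> m)"
proof (induction m rule: pm_induct)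
  case (bas j) then show ?case by (cases j) (simp_all add: op_L)
qed (simp_all add: op_linear)

lemma Rs_Y: "opRs \<omega> (opY m) = opY (opRs \<omega> m)"
proof (induction m rule: pm_induct)
  case (bas j) then show ?case by (cases j) (simp_all add: op_L op_linear)
qed (simp_all add: op_linear)

lemma SE: "opS \<omega> (opE \<omega> m) = opE \<omega> m"
proof (induction m rule: pm_induct)
  case (bas j)
  have "opS \<omega> (L2 0 P) = L2 0 P" for P
    by (induction P rule: poly_lin_induct) (simp_all add: op_linear L_monom)
  then show ?case by (cases j) (simp_all add: op_linear)
qed (simp_all add: op_linear)

lemma L_swap: "pm.plin (\<lambda>j. L1 j P) Q = pm.plin (\<lambda>i. L2 i Q) P"
  unfolding L1_def L2_def by (rule pm.plin_swap)

section \<open>The relations of the algebra under the quadratic condition\<close>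

locale quad_params =
  fixes \<omega> :: "nat \<Rightarrow> 'a::comm_ring_1"
  assumes omega_sig: "omega \<omega> (sig \<omega> a) = \<omega> a"
begin

lemma omega_sigma: "omega \<omega> (sigma \<omega> P) = omega \<omega> P"
  by (induction P rule: poly_lin_induct)
     (simp_all add: omega_sig sigma_monom omega_monom omega.add omega.scale sigma.add sigma.scale)

lemma sigma_const: "sigma \<omega> [:c:] = [:c:]"
  using sigma_monom[of \<omega> c 0] by (simp add: monom_0)

text \<open>Mirrors s1^2 = 1. Applying \<open>sigma_x\<close> twice leaves the constant omega(P) -
  omega(sigma P), which the quadratic relation kills.\<close>

lemma sigma_sigma: "sigma \<omega> (sigma \<omega> P) = P"
proof (induction P rule: poly_lin_induct)
  case (monom i)
  show ?case
  proof (induction i)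
    case 0
    show ?case by (simp add: monom_0 sigma_const)
  next
    case (Suc i)
    have "monom (1::'a) (Suc i) = monom 1 1 * monom 1 i" by (simp add: mult_monom)
    then show ?case
      by (simp only: sigma_x sigma.diff sigma_const omega_sigma Suc) simp
  qed
qed (simp_all add: sigma.add sigma.scale)

lemma sigma_sig: "sigma \<omega> (sig \<omega> b) = monom 1 b"
  using sigma_sigma[of "monom 1 b"] by (simp add: sigma_monom)

lemma Rs_Rs: "opRs \<omega> (opRs \<omega> m) = m"
proof (induction m rule: pm_induct)
  case (bas j) then show ?case by (cases j) (simp_all add: op_L sigma_sig L_monom)
qed (simp_all add: op_linear)

lemma Rs_E: "opRs \<omega> (opE \<omega> m) = opE \<omega> (opRs \<omega> m)"
proof (induction m rule: pm_induct)
  case (bas j) then show ?case by (cases j) (simp_all add: op_L op_linear sigma_sig L_monom)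
qed (simp_all add: op_linear)

text \<open>On x1^a e1 x1^b both orders put \<open>sig \<omega> a\<close> to the left of e1 and
  \<open>sig \<omega> b\<close> to its right; on \<open>T\<close> the operator \<open>opS\<close> is
  defined through \<open>opRs\<close>, which is an involution.\<close>

lemma Rs_S: "opRs \<omega> (opS \<omega> m) = opS \<omega> (opRs \<omega> m)"
proof (induction m rule: pm_induct)
  case (bas j) then show ?case
  proof (cases j)
    case (E3 a b)
    have "opRs \<omega> (L1 b (sig \<omega> a)) = pm.plin (\<lambda>i. L2 i (sig \<omega> b)) (sig \<omega> a)"
      by (simp add: L1_def Rs.plin)
    moreover have "opS \<omega> (L2 a (sig \<omega> b)) = pm.plin (\<lambda>j. L1 j (sig \<omega> a)) (sig \<omega> b)"
      by (simp add: L2_def S.plin)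
    ultimately show ?thesis using E3 by (simp add: L_swap)
  qed (simp_all add: Rs_Rs)
qed (simp_all add: op_linear)

lemma SX: "opS \<omega> (opX m) = opY (opS \<omega> m) + opE \<omega> m - m"
proof (induction m rule: pm_induct)
  case (bas j) then show ?case
  proof (cases j)
    case (T a b)
    \<comment> \<open>The \<open>T\<close> case is the \<open>U\<close> case multiplied by s1 on the
      right.\<close>
    have "opS \<omega> (opX (bas (T a b))) = opRs \<omega> (opS \<omega> (opX (bas (U a b))))" by simp
    also have "\<dots> = opY (opRs \<omega> (SU \<omega> a b)) + opE \<omega> (opRs \<omega> (bas (U a b))) - opRs \<omega> (bas (U a b))"
      by (simp add: op_linear Rs_Y op_L)
    finally show ?thesis using T by simp
  qed (simp_all add: op_linear op_L L_const L_monom)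
qed (simp_all add: op_linear)

lemma SY: "opS \<omega> (opY m) = opX (opS \<omega> m) - opE \<omega> m + m"
proof (induction m rule: pm_induct)
  case (bas j)
  \<comment> \<open>The definition of \<open>SU\<close> moves x2 past s1 only when no x1 is left.
    The same rule for every a rests on x1 x2 = x2 x1 and (x1 + x2) e1 = 0 as operator
    identities.\<close>
  have U: "SU \<omega> a (Suc b) = opX (SU \<omega> a b) - opE \<omega> (bas (U a b)) + bas (U a b)" for a b
  proof (induction a)
    case (Suc a)
    then show ?case
      using XY[of "SU \<omega> a b"] YE[of \<omega> "bas (U a b)"] by (simp add: op_linear)
  qed simp
  show ?case
  proof (cases j)
    case (T a b)
    have "opS \<omega> (opY (bas (T a b))) = opRs \<omega> (opS \<omega> (opY (bas (U a b))))" by simp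
    also have "\<dots> = opX (opRs \<omega> (SU \<omega> a b)) - opE \<omega> (opRs \<omega> (bas (U a b))) + opRs \<omega> (bas (U a b))"
      by (simp add: U op_linear Rs_X op_L)
    finally show ?thesis using T by simp
  qed (simp_all add: U op_linear op_L L_const L_monom)
qed (simp_all add: op_linear)

text \<open>
  In the algebra, \<open>e\<^sub>1 x\<^sub>1\<^sup>k s\<^sub>1 = e\<^sub>1 Q(x\<^sub>1)\<close> with \<open>Q = sig \<omega> k\<close>.  The exponent \<open>k\<close> has to be general because moving
  \<open>s\<^sub>1\<close> past \<open>x\<^sub>1\<close> or \<open>x\<^sub>2\<close> raises it.
\<close>

lemma EXS_U:
  "opE \<omega> ((opX ^^ k) (SU \<omega> a b)) = pm_scale ((-1) ^ b) (L2 0 (monom 1 (a + b) * sig \<omega> k))"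
proof -
  have step: "monom 1 i * sig \<omega> (Suc k) =
      smult (\<omega> k) (monom 1 i) - monom 1 (i + k) - monom 1 (Suc i) * sig \<omega> k" for i k
    by (simp add: right_diff_distrib mult_monom flip: mult.assoc)
  have XkX: "(opX ^^ k) (opX m) = (opX ^^ Suc k) m" for k and m :: "idx \<Rightarrow>\<^sub>0 'a"
    by (simp add: funpow_swap1)
  have XXk: "opX ((opX ^^ k) m) = (opX ^^ Suc k) m" for k and m :: "idx \<Rightarrow>\<^sub>0 'a"
    by simp
  have XkY: "(opX ^^ k) (opY m) = opY ((opX ^^ k) m)" for k and m :: "idx \<Rightarrow>\<^sub>0 'a"
    by (induction k) (simp_all add: XY)
  show ?thesis
  proof (induction a arbitrary: k)
    case 0
    show ?case
    proof (induction b arbitrary: k)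
      case 0
      show ?case by (simp add: Xk_T)
    next
      case (Suc b)
      show ?case
        by (simp add: Xk.add Xk.diff XkX Xk.scale Xk_E3 Xk_U op_linear Suc step L_monom mult.commute add.commute
            del: funpow.simps sig.simps)
    qed
  next
    case (Suc a)
    show ?case
      by (simp add: Xk.add Xk.diff XkY XXk EY Xk.scale Xk_E3 Xk_U op_linear Suc step L_monom add_ac mult.commute[of _ "\<omega> k"]
          del: funpow.simps sig.simps)
  qed
qed

lemma ES: "opE \<omega> (opS \<omega> m) = opE \<omega> m"
proof (induction m rule: pm_induct)
  case (bas j)
  have U: "opE \<omega> (SU \<omega> a b) = opE \<omega> (bas (U a b))" for a b
    using EXS_U[of 0] by (simp add: L_monom)
  show ?case
    by (cases j) (simp_all add: op_L omega_sig U Rs_E [symmetric] op_linear)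
qed (simp_all add: op_linear)

text \<open>s1 s1 x1 m = s1 (x2 s1 m + e1 m - m) = x1 s1 s1 m - e1 s1 m + s1 m + s1 e1 m - s1 m, and
  e1 s1 = e1 = s1 e1 cancels all but the first term.\<close>

lemma SS_X: "opS \<omega> (opS \<omega> m) = m \<Longrightarrow> opS \<omega> (opS \<omega> (opX m)) = opX m"
  by (simp add: SX SY op_linear ES SE)

lemma SS_Y: "opS \<omega> (opS \<omega> m) = m \<Longrightarrow> opS \<omega> (opS \<omega> (opY m)) = opY m"
  by (simp add: SX SY op_linear ES SE)

lemma SS_U: "opS \<omega> (opS \<omega> (bas (U a b))) = bas (U a b)"
proof (induction a)
  case 0
  show ?case
  proof (induction b)
    case (Suc b)
    from SS_Y[OF this] show ?case by simp
  qed simp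
next
  case (Suc a)
  from SS_X[OF this] show ?case by simp
qed

lemma SS: "opS \<omega> (opS \<omega> m) = m"
proof (induction m rule: pm_induct)
  case (bas j) then show ?case
  proof (cases j)
    case (T a b)
    have "opS \<omega> (opS \<omega> (bas (T a b))) = opRs \<omega> (opS \<omega> (opS \<omega> (bas (U a b))))"
      by (simp only: Rs_S op_bas)
    also have "\<dots> = bas (T a b)" by (simp only: SS_U) simp
    finally show ?thesis using T by simp
  qed (simp_all add: op_L sigma_sig L_monom SS_U [simplified])
qed (simp_all add: op_linear)

end

section \<open>The two-sided ideal generated by the cyclotomic relation\<close>

definition pop :: "((idx \<Rightarrow>\<^sub>0 'a) \<Rightarrow> (idx \<Rightarrow>\<^sub>0 'a)) \<Rightarrow> 'a::comm_ring_1 poly \<Rightarrow> (idx \<Rightarrow>\<^sub>0 'a) \<Rightarrow> (idx \<Rightarrow>\<^sub>0 'a)" where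
  "pop F P m = pm.plin (\<lambda>i. (F ^^ i) m) P"

lemma lhom_pop:
  assumes "lhom pm_scale pm_scale F" shows "lhom pm_scale pm_scale (pop F P)"
proof -
  interpret F: lhom pm_scale pm_scale F by fact
  interpret Fk: lhom pm_scale pm_scale "F ^^ k" for k
    by (rule lhom_funpow) fact
  show ?thesis
    by unfold_locales
       (simp_all add: pop_def pm.plin_def Fk.add Fk.scale pm.scale_right_distrib sum.distrib
         pm.scale_sum_right mult.commute)
qed

global_interpretation popX: lhom pm_scale pm_scale "pop opX P" for P
  by (rule lhom_pop) (rule X.lhom_axioms)
global_interpretation popR: lhom pm_scale pm_scale "pop opRx P" for P
  by (rule lhom_pop) (rule Rx.lhom_axioms)

lemma pop_comm:
  assumes "lhom pm_scale pm_scale f" "\<And>m. f (F m) = F (f m)"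
  shows "f (pop F P m) = pop F P (f m)"
proof -
  interpret lhom pm_scale pm_scale f by fact
  have "f ((F ^^ i) m) = (F ^^ i) (f m)" for i
    by (induction i) (simp_all add: assms)
  then show ?thesis
    using plin[of "\<lambda>i. (F ^^ i) m" P] by (simp add: pop_def)
qed

lemma Rx_X: "opRx (opX m) = opX (opRx m)"
proof (induction m rule: pm_induct)
  case (bas j) then show ?case by (cases j) (simp_all add: op_linear)
qed (simp_all add: op_linear)

lemma Rx_Y: "opRx (opY m) = opY (opRx m)"
proof (induction m rule: pm_induct)
  case (bas j) then show ?case by (cases j) (simp_all add: op_linear)
qed (simp_all add: op_linear)

lemma Rx_E: "opRx (opE \<omega> m) = opE \<omega> (opRx m)"
proof (induction m rule: pm_induct)
  case (bas j) then show ?case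
    by (cases j) (simp_all add: op_linear op_L L_monom L_const mult.commute)
qed (simp_all add: op_linear)

lemma RxX_U: "(opRx ^^ i) (bas (U a b)) = bas (U (i + a) b)"
  by (induction i) simp_all

lemma RxX_E3: "(opRx ^^ i) (bas (E3 a b)) = bas (E3 a (i + b))"
  by (induction i) simp_all

lemma pop_E3:
  "pop opX P (bas (E3 a b)) = L1 b (monom 1 a * P)"
  "pop opRx P (bas (E3 a b)) = L2 a (monom 1 b * P)"
  by (induction P rule: poly_lin_induct)
     (simp_all add: pop_def Xk_E3 RxX_E3 pm.plin_monom pm.plin.add pm.plin.scale op_linear
       mult_monom L_monom distrib_left add.commute)

text \<open>x1 commutes with x1^a x2^b; this turns left multiples by p(x1) into right ones.\<close>

lemma pop_U: "pop opX P (bas (U a b)) = pop opRx P (bas (U a b))"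
  by (simp add: pop_def Xk_U RxX_U)

context quad_params
begin

lemma Rx_S_X: "opRx (opS \<omega> m) = opS \<omega> (opRx m) \<Longrightarrow> opRx (opS \<omega> (opX m)) = opS \<omega> (opRx (opX m))"
  by (simp add: SX op_linear Rx_Y Rx_E Rx_X)

lemma Rx_S_Y: "opRx (opS \<omega> m) = opS \<omega> (opRx m) \<Longrightarrow> opRx (opS \<omega> (opY m)) = opS \<omega> (opRx (opY m))"
  by (simp add: SY op_linear Rx_Y Rx_E Rx_X)

text \<open>The vectors \<open>U a b\<close> and \<open>T a b\<close> arise from
  \<open>U 0 0\<close> and \<open>T 0 0\<close> by x1 and x2, and the commutation survives both
  operators.\<close>

lemma Rx_S: "opRx (opS \<omega> m) = opS \<omega> (opRx m)"
proof (induction m rule: pm_induct)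
  case (bas j)
  show ?case
  proof (cases j)
    case (E3 a b)
    then show ?thesis by (simp add: op_L)
  next
    case (U a b)
    have "opRx (opS \<omega> (bas (U a b))) = opS \<omega> (opRx (bas (U a b)))"
    proof (induction a)
      case 0
      show ?case
      proof (induction b)
        case 0 show ?case by (simp add: op_linear)
      next
        case (Suc b)
        from Rx_S_Y[OF this] show ?case by (simp only: op_bas)
      qed
    next
      case (Suc a)
      from Rx_S_X[OF this] show ?case by (simp only: op_bas)
    qed
    with U show ?thesis by simp
  next
    case (T a b)
    have "opRx (opS \<omega> (bas (T a b))) = opS \<omega> (opRx (bas (T a b)))"
    proof (induction a)
      case 0
      show ?case
      proof (induction b)
        case 0 show ?case by (simp add: op_linear)
      next
        case (Suc b)
        from Rx_S_Y[OF this] show ?case by (simp only: op_bas(5))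
      qed
    next
      case (Suc a)
      from Rx_S_X[OF this] show ?case by (simp only: op_bas(2))
    qed
    with T show ?thesis by simp
  qed
qed (simp_all add: op_linear)

end

text \<open>\<open>sigma_p\<close> and \<open>omega_p\<close> are admissibility in the form of
  \<open>admissible_iff\<close>; the instance has p = prod (t - u_i) and \<tau> = (-1)^r.\<close>

locale cyc_params = quad_params \<omega> for \<omega> :: "nat \<Rightarrow> 'a::comm_ring_1" +
  fixes p :: "'a poly" and \<tau> :: 'a
  assumes monic: "lead_coeff p = 1"
    and sigma_p: "sigma \<omega> p = smult \<tau> p"
    and omega_p: "omega \<omega> (monom 1 a * p) = 0"
    and two_unit: "(2::'a) dvd 1"
begin

lemma omega_mult_p: "omega \<omega> (P * p) = 0"
  by (induction P rule: poly_lin_induct) (simp_all add: omega_p distrib_right omega.add omega.scale)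

text \<open>In \<open>sigma_x\<close> the constant omega(t^i p) vanishes, so the recursion stays
  inside the multiples of p. This makes \<open>cyc_ideal\<close> stable under s1.\<close>

lemma sigma_mult_p: "\<exists>Q. sigma \<omega> (P * p) = Q * p"
proof (induction P rule: poly_lin_induct)
  case (monom i)
  show ?case
  proof (induction i)
    case 0
    show ?case by (intro exI[of _ "[:\<tau>:]"]) (simp add: sigma_p)
  next
    case (Suc i)
    then obtain Q where Q: "sigma \<omega> (monom 1 i * p) = Q * p" by blast
    have "monom 1 (Suc i) * p = monom 1 1 * (monom 1 i * p)"
      by (simp add: mult_monom flip: mult.assoc)
    then have "sigma \<omega> (monom 1 (Suc i) * p) = (- monom 1 i - monom 1 1 * Q) * p"
      by (simp only: sigma_x omega_p Q left_diff_distrib mult_minus_left mult.assoc) simp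
    then show ?case by blast
  qed
next
  case (add P Q)
  then obtain P' Q' where "sigma \<omega> (P * p) = P' * p" "sigma \<omega> (Q * p) = Q' * p" by blast
  then have "sigma \<omega> ((P + Q) * p) = (P' + Q') * p" by (simp add: distrib_right sigma.add)
  then show ?case by blast
next
  case (scale c P)
  then obtain P' where "sigma \<omega> (P * p) = P' * p" by blast
  then have "sigma \<omega> (smult c P * p) = smult c P' * p" by (simp add: sigma.scale)
  then show ?case by blast
qed

text \<open>
  The three generators are \<open>w p(x\<^sub>1)\<close>, \<open>w p(x\<^sub>1) s\<^sub>1\<close> and \<open>(P p)(x\<^sub>1) e\<^sub>1 x\<^sub>1\<^sup>b\<close>.  Since right multiplications commute
  with the left action, stability under the latter only has to be verified on the last one.
\<close>

inductive_set cyc_ideal :: "(idx \<Rightarrow>\<^sub>0 'a) set" where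
  right: "pop opRx p m \<in> cyc_ideal"
| right_s: "opRs \<omega> (pop opRx p m) \<in> cyc_ideal"
| left: "L1 b (P * p) \<in> cyc_ideal"
| add: "m \<in> cyc_ideal \<Longrightarrow> n \<in> cyc_ideal \<Longrightarrow> m + n \<in> cyc_ideal"

lemma cyc_ideal_zero: "0 \<in> cyc_ideal"
  using right[of 0] by simp

lemma cyc_ideal_scale: "m \<in> cyc_ideal \<Longrightarrow> pm_scale c m \<in> cyc_ideal"
proof (induction rule: cyc_ideal.induct)
  case (left b P)
  show ?case using cyc_ideal.left[of b "smult c P"] by (simp add: L1.scale)
qed (auto simp: pm.scale_right_distrib intro: cyc_ideal.intros simp flip: popR.scale Rs.scale)

lemma cyc_ideal_X: "m \<in> cyc_ideal \<Longrightarrow> opX m \<in> cyc_ideal"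
proof (induction rule: cyc_ideal.induct)
  case (left b P)
  show ?case using cyc_ideal.left[of b "monom 1 1 * P"] by (simp only: op_L mult.assoc)
qed (auto simp: op_linear pop_comm[OF X.lhom_axioms] Rx_X intro: cyc_ideal.intros simp flip: Rs_X)

lemma cyc_ideal_Y: "m \<in> cyc_ideal \<Longrightarrow> opY m \<in> cyc_ideal"
proof (induction rule: cyc_ideal.induct)
  case (left b P)
  show ?case using cyc_ideal.left[of b "- (monom 1 1 * P)"] by (simp only: op_L mult.assoc L1.neg mult_minus_left)
qed (auto simp: op_linear pop_comm[OF Y.lhom_axioms] Rx_Y intro: cyc_ideal.intros simp flip: Rs_Y)

lemma cyc_ideal_E: "m \<in> cyc_ideal \<Longrightarrow> opE \<omega> m \<in> cyc_ideal"
  by (induction rule: cyc_ideal.induct)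
     (auto simp: op_linear pop_comm[OF E.lhom_axioms] Rx_E op_L omega_mult_p cyc_ideal_zero intro: cyc_ideal.intros
       simp flip: Rs_E)

lemma cyc_ideal_S: "m \<in> cyc_ideal \<Longrightarrow> opS \<omega> m \<in> cyc_ideal"
proof (induction rule: cyc_ideal.induct)
  case (left b P)
  obtain Q where "sigma \<omega> (P * p) = Q * p" using sigma_mult_p by blast
  then show ?case using cyc_ideal.left[of b Q] by (simp add: op_L)
qed (auto simp: op_linear pop_comm[OF S.lhom_axioms] Rx_S intro: cyc_ideal.intros simp flip: Rs_S)

text \<open>The relator p(x1) acts as zero modulo \<open>cyc_ideal\<close>: it can be moved to the
  right of x1^a x2^b, also when s1 follows, and on x1^a e1 x1^b it gives a generator of the third
  kind.\<close>

lemma pop_X_in_cyc_ideal: "pop opX p m \<in> cyc_ideal"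
proof (induction m rule: pm_induct)
  case (bas j) then show ?case
  proof (cases j)
    case (T a b)
    have "pop opX p (bas (T a b)) = opRs \<omega> (pop opRx p (bas (U a b)))"
      by (simp add: pop_comm[OF Rs.lhom_axioms] Rs_X flip: pop_U)
    with T show ?thesis by (simp add: right_s)
  qed (simp_all add: pop_E3 pop_U left right)
qed (simp_all add: popX.add popX.scale add cyc_ideal_scale)

end

section \<open>Elements of low degree\<close>

text \<open>In \<^typ>\<open>'a poly poly\<close> the inner variable records the exponent \<open>a\<close> of a basis vector, the outer one \<open>b\<close>.\<close>

interpretation pp: lmod "\<lambda>c :: 'a::comm_ring_1. smult [:c:] :: 'a poly poly \<Rightarrow> 'a poly poly"
  by unfold_locales (auto simp: smult_add_right smult_add_left smult_add_left [of "[:_:]" "[:_:]", simplified]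
      mult.commute simp flip: one_pCons)

definition coordE :: "(idx \<Rightarrow>\<^sub>0 'a::comm_ring_1) \<Rightarrow> 'a poly poly" where
  "coordE = pp.lext (case_idx (\<lambda>a b. monom (monom 1 a) b) (\<lambda>a b. 0) (\<lambda>a b. 0))"

definition coordT :: "(idx \<Rightarrow>\<^sub>0 'a::comm_ring_1) \<Rightarrow> 'a poly poly" where
  "coordT = pp.lext (case_idx (\<lambda>a b. 0) (\<lambda>a b. monom (monom 1 a) b) (\<lambda>a b. 0))"

definition coordU :: "(idx \<Rightarrow>\<^sub>0 'a::comm_ring_1) \<Rightarrow> 'a poly poly" where
  "coordU = pp.lext (case_idx (\<lambda>a b. 0) (\<lambda>a b. 0) (\<lambda>a b. monom (monom 1 a) b))"

global_interpretation coordE: lhom pm_scale "\<lambda>c. smult [:c:]" coordE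
  unfolding coordE_def by (rule pp.hom_lext)
global_interpretation coordT: lhom pm_scale "\<lambda>c. smult [:c:]" coordT
  unfolding coordT_def by (rule pp.hom_lext)
global_interpretation coordU: lhom pm_scale "\<lambda>c. smult [:c:]" coordU
  unfolding coordU_def by (rule pp.hom_lext)

lemma coord_bas [simp]:
  "coordE (bas (E3 a b)) = monom (monom 1 a) b" "coordE (bas (T a b)) = 0" "coordE (bas (U a b)) = 0"
  "coordT (bas (E3 a b)) = 0" "coordT (bas (T a b)) = monom (monom 1 a) b" "coordT (bas (U a b)) = 0"
  "coordU (bas (E3 a b)) = 0" "coordU (bas (T a b)) = 0" "coordU (bas (U a b)) = monom (monom 1 a) b"
  by (simp_all add: coordE_def coordT_def coordU_def)

lemmas coord_linear =
  coordE.add coordE.scale coordE.diff coordE.neg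
  coordT.add coordT.scale coordT.diff coordT.neg
  coordU.add coordU.scale coordU.diff coordU.neg

lemma lookup_bas: "Poly_Mapping.lookup (bas k) j = (if k = j then 1 else 0)"
  by (simp add: bas_def lookup_single when_def)

lemma coeff_coord:
  "coeff (coeff (coordE m) b) a = Poly_Mapping.lookup m (E3 a b)"
  "coeff (coeff (coordT m) b) a = Poly_Mapping.lookup m (T a b)"
  "coeff (coeff (coordU m) b) a = Poly_Mapping.lookup m (U a b)"
proof (induction m rule: pm_induct)
  case (bas k)
  { case 1 show ?case by (cases k) (auto simp: lookup_bas) }
  { case 2 show ?case by (cases k) (auto simp: lookup_bas) }
  { case 3 show ?case by (cases k) (auto simp: lookup_bas) }
qed (simp_all add: coord_linear lookup_add)

lemma coord_eq_0: "coordE m = 0 \<Longrightarrow> coordT m = 0 \<Longrightarrow> coordU m = 0 \<Longrightarrow> m = 0"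
  by (rule poly_mapping_eqI) (metis coeff_coord coeff_0 idx.exhaust lookup_zero)

lemma coord_X:
  "coordE (opX m) = smult (monom 1 1) (coordE m)"
  "coordT (opX m) = smult (monom 1 1) (coordT m)"
  "coordU (opX m) = smult (monom 1 1) (coordU m)"
proof (induction m rule: pm_induct)
  case (bas k)
  { case 1 show ?case by (cases k) (auto simp: smult_monom mult_monom) }
  { case 2 show ?case by (cases k) (auto simp: smult_monom mult_monom) }
  { case 3 show ?case by (cases k) (auto simp: smult_monom mult_monom) }
qed (simp_all add: coord_linear op_linear smult_add_right)

lemma coord_Y:
  "coordE (opY m) = - smult (monom 1 1) (coordE m)"
  "coordT (opY m) = pCons 0 (coordT m)"
  "coordU (opY m) = pCons 0 (coordU m)"
proof (induction m rule: pm_induct)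
  case (bas k)
  { case 1 show ?case by (cases k) (auto simp: smult_monom mult_monom coord_linear) }
  { case 2 show ?case by (cases k) (auto simp: monom_Suc coord_linear) }
  { case 3 show ?case by (cases k) (auto simp: monom_Suc coord_linear) }
next
  case (add m n)
  { case 1 show ?case by (simp add: coord_linear op_linear smult_add_right add) }
  { case 2 show ?case using add(2,5) by (simp add: coord_linear op_linear) }
  { case 3 show ?case using add(3,6) by (simp add: coord_linear op_linear) }
next
  case (scale c m)
  { case 1 show ?case by (simp add: coord_linear op_linear scale mult.commute) }
  { case 2 show ?case using scale(2) by (simp add: coord_linear op_linear) }
  { case 3 show ?case using scale(3) by (simp add: coord_linear op_linear) }
qed

lemma coord_Rs:
  "coordT (opRs \<omega> m) = coordU m"
  "coordU (opRs \<omega> m) = coordT m"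
proof (induction m rule: pm_induct)
  case (bas k)
  have *: "coordT (L2 a P) = 0" "coordU (L2 a P) = 0" for a and P :: "'a poly"
    by (induction P rule: poly_lin_induct) (simp_all add: L_monom op_linear coord_linear)
  { case 1 show ?case by (cases k) (auto simp: *) }
  { case 2 show ?case by (cases k) (auto simp: *) }
qed (simp_all add: coord_linear op_linear)

lemma coord_L:
  "coordT (L1 a P) = 0" "coordU (L1 a P) = 0" "coordE (L1 a P) = monom P a"
  "coordT (L2 a P) = 0" "coordU (L2 a P) = 0" 
  "coordE (L2 a P) = smult (monom 1 a) (map_poly (\<lambda>c. [:c:]) P)"
proof -
  have "coeff (coordE (L2 a P)) j = coeff (smult (monom 1 a) (map_poly (\<lambda>c. [:c:]) P)) j" for j
  proof (induction P rule: poly_lin_induct)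
    case (monom i) then show ?case
      by (simp add: L_monom map_poly_monom smult_monom)
  qed (simp_all add: coord_linear op_linear coeff_map_poly smult_add_left mult.commute)
  then show "coordE (L2 a P) = smult (monom 1 a) (map_poly (\<lambda>c. [:c:]) P)" by (rule poly_eqI)
qed (induction P rule: poly_lin_induct; simp add: L_monom op_linear coord_linear add_monom smult_monom)+

lemma map_const_mult:
  "map_poly (\<lambda>c. [:c:]) (P * Q) = map_poly (\<lambda>c. [:c:]) P * map_poly (\<lambda>c. [:c:]) (Q :: 'a::comm_ring_1 poly)"
proof -
  have sum: "[:\<Sum>i\<in>A. f i:] = (\<Sum>i\<in>A. [:f i:])" for A :: "nat set" and f :: "nat \<Rightarrow> 'a"
    by (auto simp: poly_eq_iff coeff_sum coeff_pCons split: nat.splits)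
  show ?thesis
    by (rule poly_eqI) (simp add: coeff_map_poly coeff_mult sum mult.commute)
qed

text \<open>Modulo p, a multiple of the monic M of degree below that of M is zero. Instead of
  working over the quotient ring, the proof strips leading terms of G: A has no coefficient at
  degree G + degree M, so the leading coefficient of G is a multiple of p.\<close>

lemma monic_division_unique:
  fixes p :: "'b::comm_ring_1" and G K M A :: "'b poly"
  assumes "lead_coeff M = 1" "G * M + smult p K = A" "\<And>j. j \<ge> degree M \<Longrightarrow> coeff A j = 0"
  shows "\<exists>G'. G = smult p G'"
  using assms(2)
\<comment> \<open>The measure distinguishes G = 0 from a nonzero constant, both of degree 0.\<close>
proof (induction "if G = 0 then 0 else Suc (degree G)" arbitrary: G K rule: less_induct)
  case less
  show ?case
  proof (cases "G = 0")
    case False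
    let ?d = "degree G" and ?r = "degree M"
    define k where "k = - coeff K (?d + ?r)"
    have "coeff (G * M) (?d + ?r) = lead_coeff G"
      using assms(1) by (simp add: coeff_mult_degree_sum)
    then have "lead_coeff G + p * coeff K (?d + ?r) = 0"
      using arg_cong[OF less.prems, of "\<lambda>A. coeff A (?d + ?r)"] assms(3) by simp
    then have k: "lead_coeff G = p * k"
      by (simp add: k_def eq_neg_iff_add_eq_0)
    define H where "H = G - monom (lead_coeff G) ?d"
    have "H = 0 \<or> degree H < ?d"
    proof (cases ?d)
      case 0
      then show ?thesis by (auto simp: H_def monom_0 elim: degree_eq_zeroE)
    next
      case (Suc d)
      have "degree H \<le> d"
        by (rule degree_le) (use Suc in \<open>auto simp: H_def coeff_eq_0\<close>)
      with Suc show ?thesis by simp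
    qed
    moreover have "H * M + smult p (K + monom k ?d * M) = A"
    proof -
      have "monom (lead_coeff G) ?d = smult p (monom k ?d)" by (simp add: k smult_monom)
      with less.prems show ?thesis by (simp add: H_def algebra_simps smult_add_right)
    qed
    ultimately obtain H' where "H = smult p H'"
      using less.hyps[OF _ \<open>H * M + _ = A\<close>] False by (cases "H = 0") auto
    then have "G = smult p (H' + monom k ?d)"
      by (simp add: H_def k smult_add_right smult_monom algebra_simps)
    then show ?thesis by blast
  qed (auto intro: exI[of _ 0])
qed

lemma monic_multiple_low:
  fixes p k :: "'b::comm_ring_1 poly"
  assumes "lead_coeff p = 1" "\<And>j. j \<ge> degree p \<Longrightarrow> coeff (p * k) j = 0"
  shows "k = 0"
proof -
  have "coeff (p * k) (degree p + degree k) = lead_coeff k"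
    using assms(1) by (simp add: coeff_mult_degree_sum)
  with assms(2) show ?thesis by simp
qed

lemma monic_smult_low:
  fixes p :: "'b::comm_ring_1 poly" and K :: "'b poly poly"
  assumes "lead_coeff p = 1" "\<And>b j. j \<ge> degree p \<Longrightarrow> coeff (coeff (smult p K) b) j = 0"
  shows "smult p K = 0"
proof -
  have "coeff K b = 0" for b
    by (rule monic_multiple_low[OF assms(1)]) (use assms(2)[of _ b] in simp)
  then have "K = 0" by (intro poly_eqI) simp
  then show ?thesis by simp
qed

section \<open>Coordinates of elements of the two-sided ideal\<close>

context cyc_params
begin

text \<open>
  \<open>kappa\<close> is \<open>s\<^sub>1 p(x\<^sub>1)\<close>, which equals \<open>p(x\<^sub>2) s\<^sub>1\<close> up to terms \<open>x\<^sub>1\<^sup>a x\<^sub>2\<^sup>b\<close> with \<open>b < degree p\<close> and terms with \<open>e\<^sub>1\<close>.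
\<close>

definition kappa :: "idx \<Rightarrow>\<^sub>0 'a" where
  "kappa = pop opRx p (bas (T 0 0))"

text \<open>p in the outer variable: p(x2) for \<open>T\<close> and \<open>U\<close> coordinates,
  p(x1) to the right of e1 for \<open>E3\<close> coordinates.\<close>

definition py :: "'a poly poly" where
  "py = map_poly (\<lambda>c. [:c:]) p"

lemma kappa_eq: "kappa = pm.plin (\<lambda>i. SU \<omega> i 0) p"
proof -
  have "kappa = opS \<omega> (pop opRx p (bas (U 0 0)))"
    by (simp add: kappa_def pop_comm[OF S.lhom_axioms] Rx_S)
  also have "\<dots> = pm.plin (\<lambda>i. SU \<omega> i 0) p"
    by (simp add: pop_def RxX_U S.plin)
  finally show ?thesis .
qed

lemma coordT_kappa: "coordT kappa = py"
proof -
  have "coordT (SU \<omega> i 0) = monom 1 i" for i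
    by (induction i) (simp_all add: coord_linear coord_Y op_linear monom_Suc monom_0 one_pCons)
  then have "coordT kappa = pp.plin (monom 1) p"
    by (simp add: kappa_eq coordT.plin)
  also have "pp.plin (monom 1) P = map_poly (\<lambda>c. [:c:]) P" for P :: "'a poly"
  proof (rule poly_eqI)
    show "coeff (pp.plin (monom 1) P) j = coeff (map_poly (\<lambda>c. [:c:]) P) j" for j
      by (induction P rule: poly_lin_induct)
         (simp_all add: pp.plin_monom pp.plin.add pp.plin.scale coeff_map_poly)
  qed
  finally show ?thesis by (simp add: py_def)
qed

lemma coordU_kappa: "j \<ge> degree p \<Longrightarrow> coeff (coordU kappa) j = 0"
proof -
  have *: "j \<ge> i \<Longrightarrow> coeff (coordU (SU \<omega> i 0)) j = 0" for i j
  proof (induction i arbitrary: j)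
    case (Suc i)
    then show ?case
      by (cases j) (simp_all add: coord_linear coord_Y op_linear)
  qed simp
  assume "j \<ge> degree p"
  then show ?thesis
    by (simp add: kappa_eq coordU.plin pp.plin_def coeff_sum *)
qed

definition neg_x :: "'a poly" where "neg_x = - monom 1 1"

text \<open>The shape of F1 kappa + F2 kappa s1, with F1 and F2 polynomials in x1 and x2, plus left
  multiples of p(x1) and terms x1^a e1 P(x1) p(x1). Right multiplication by s1 swaps the
  \<open>T\<close> and \<open>U\<close> coordinates of kappa, whence the crossed roles of F1 and F2;
  x2 acts as -x1 in front of e1, whence \<open>neg_x\<close>.\<close>

definition cyc_form :: "(idx \<Rightarrow>\<^sub>0 'a) \<Rightarrow> bool" where
  "cyc_form m \<longleftrightarrow> (\<exists>F1 F2 K1 K2 K3 G.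
     coordT m = smult p K1 + F1 * py + F2 * coordU kappa \<and>
     coordU m = smult p K2 + F2 * py + F1 * coordU kappa \<and>
     coordE m = smult p K3 + G * py + smult (poly F1 neg_x) (coordE kappa)
       + smult (poly F2 neg_x) (coordE (opRs \<omega> kappa)))"

lemma cyc_formI:
  assumes "coordT m = smult p K1 + F1 * py + F2 * coordU kappa"
    "coordU m = smult p K2 + F2 * py + F1 * coordU kappa"
    "coordE m = smult p K3 + G * py + smult (poly F1 neg_x) (coordE kappa)
       + smult (poly F2 neg_x) (coordE (opRs \<omega> kappa))"
  shows "cyc_form m"
  using assms unfolding cyc_form_def by blast

lemma cyc_form_add: "cyc_form m \<Longrightarrow> cyc_form n \<Longrightarrow> cyc_form (m + n)"
proof -
  assume "cyc_form m" "cyc_form n"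
  then obtain F1 F2 K1 K2 K3 G F1' F2' K1' K2' K3' G' where *:
     "coordT m = smult p K1 + F1 * py + F2 * coordU kappa"
     "coordU m = smult p K2 + F2 * py + F1 * coordU kappa"
     "coordE m = smult p K3 + G * py + smult (poly F1 neg_x) (coordE kappa)
       + smult (poly F2 neg_x) (coordE (opRs \<omega> kappa))"
     "coordT n = smult p K1' + F1' * py + F2' * coordU kappa"
     "coordU n = smult p K2' + F2' * py + F1' * coordU kappa"
     "coordE n = smult p K3' + G' * py + smult (poly F1' neg_x) (coordE kappa)
       + smult (poly F2' neg_x) (coordE (opRs \<omega> kappa))"
    unfolding cyc_form_def by blast
  show "cyc_form (m + n)"
    by (rule cyc_formI[of _ "K1 + K1'" "F1 + F1'" "F2 + F2'" "K2 + K2'" "K3 + K3'" "G + G'"])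
       (simp_all add: coord_linear * smult_add_right smult_add_left algebra_simps)
qed

lemma cyc_form_scale: "cyc_form m \<Longrightarrow> cyc_form (pm_scale c m)"
proof -
  assume "cyc_form m"
  then obtain F1 F2 K1 K2 K3 G where *:
     "coordT m = smult p K1 + F1 * py + F2 * coordU kappa"
     "coordU m = smult p K2 + F2 * py + F1 * coordU kappa"
     "coordE m = smult p K3 + G * py + smult (poly F1 neg_x) (coordE kappa)
       + smult (poly F2 neg_x) (coordE (opRs \<omega> kappa))"
    unfolding cyc_form_def by blast
  let ?s = "smult [:c:]"
  show ?thesis
    by (rule cyc_formI[of _ "?s K1" "?s F1" "?s F2" "?s K2" "?s K3" "?s G"])
       (simp_all add: coord_linear * smult_add_right mult.commute)
qed

lemma cyc_form_X: "cyc_form m \<Longrightarrow> cyc_form (opX m)"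
proof -
  assume "cyc_form m"
  then obtain F1 F2 K1 K2 K3 G where *:
     "coordT m = smult p K1 + F1 * py + F2 * coordU kappa"
     "coordU m = smult p K2 + F2 * py + F1 * coordU kappa"
     "coordE m = smult p K3 + G * py + smult (poly F1 neg_x) (coordE kappa)
       + smult (poly F2 neg_x) (coordE (opRs \<omega> kappa))"
    unfolding cyc_form_def by blast
  let ?s = "smult (monom 1 1)"
  show ?thesis
    by (rule cyc_formI[of _ "?s K1" "?s F1" "?s F2" "?s K2" "?s K3" "?s G"])
       (simp_all add: coord_X * smult_add_right mult.commute)
qed

lemma cyc_form_Y: "cyc_form m \<Longrightarrow> cyc_form (opY m)"
proof -
  assume "cyc_form m"
  then obtain F1 F2 K1 K2 K3 G where *:
     "coordT m = smult p K1 + F1 * py + F2 * coordU kappa"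
     "coordU m = smult p K2 + F2 * py + F1 * coordU kappa"
     "coordE m = smult p K3 + G * py + smult (poly F1 neg_x) (coordE kappa)
       + smult (poly F2 neg_x) (coordE (opRs \<omega> kappa))"
    unfolding cyc_form_def by blast
  let ?s = "smult neg_x"
  have s: "coordE (opY m) = ?s (coordE m)" by (simp add: coord_Y neg_x_def)
  show ?thesis
    by (rule cyc_formI[of _ "pCons 0 K1" "pCons 0 F1" "pCons 0 F2" "pCons 0 K2" "?s K3" "?s G"])
       (simp_all add: s coord_Y(2,3) * smult_add_right mult.commute)
qed

text \<open>Right multiplication of \<open>T a b\<close> by p(x1) gives x1^a x2^b kappa, so the
  claim spreads from kappa by \<open>opX\<close> and \<open>opY\<close>.\<close>

lemma cyc_form_T: "cyc_form (pop opRx p (bas (T a b)))" "cyc_form (opRs \<omega> (pop opRx p (bas (T a b))))"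
proof -
  have "cyc_form kappa"
    by (rule cyc_formI[of _ 0 1 0 0 0 0]) (simp_all add: coordT_kappa)
  moreover have "cyc_form (opRs \<omega> kappa)"
    by (rule cyc_formI[of _ 0 0 1 0 0 0]) (simp_all add: coordT_kappa coord_Rs)
  ultimately have *: "cyc_form (pop opRx p (bas (T 0 b))) \<and> cyc_form (opRs \<omega> (pop opRx p (bas (T 0 b))))" for b
  proof (induction b)
    case (Suc b)
    have "pop opRx p (bas (T 0 (Suc b))) = opY (pop opRx p (bas (T 0 b)))"
      by (simp add: pop_comm[OF Y.lhom_axioms] Rx_Y)
    with Suc show ?case by (simp add: cyc_form_Y Rs_Y)
  qed (simp add: kappa_def)
  have "cyc_form (pop opRx p (bas (T a b))) \<and> cyc_form (opRs \<omega> (pop opRx p (bas (T a b))))"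
  proof (induction a)
    case (Suc a)
    have "pop opRx p (bas (T (Suc a) b)) = opX (pop opRx p (bas (T a b)))"
      by (simp add: pop_comm[OF X.lhom_axioms] Rx_X)
    with Suc show ?case by (simp add: cyc_form_X Rs_X)
  qed (simp add: *)
  then show "cyc_form (pop opRx p (bas (T a b)))" "cyc_form (opRs \<omega> (pop opRx p (bas (T a b))))"
    by simp_all
qed

lemma coord_pop_U:
  "coordE (pop opRx P (bas (U a b))) = 0" "coordT (pop opRx P (bas (U a b))) = 0"
  "coordU (pop opRx P (bas (U a b))) = smult P (monom (monom 1 a) b)"
  by (induction P rule: poly_lin_induct)
     (simp_all add: pop_def RxX_U pm.plin_monom pm.plin.add pm.plin.scale coord_linear smult_add_left
       smult_monom mult_monom distrib_right add_monom)

lemma coordE_pop_U: "coordE (opRs \<omega> (pop opRx P (bas (U a b)))) = 0"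
  by (induction P rule: poly_lin_induct)
     (simp_all add: pop_def RxX_U pm.plin_monom pm.plin.add pm.plin.scale coord_linear op_linear)

lemma cyc_form_L2: "cyc_form (L2 a (P * p))"
proof (rule cyc_formI[of _ 0 0 0 0 0 "smult (monom 1 a) (map_poly (\<lambda>c. [:c:]) P)"])
qed (simp_all add: coord_L map_const_mult py_def)

lemma cyc_form_right: "cyc_form (pop opRx p m) \<and> cyc_form (opRs \<omega> (pop opRx p m))"
proof (induction m rule: pm_induct)
  case (bas k)
  show ?case
  proof (cases k)
    case (E3 a b)
    obtain Q where "sigma \<omega> (monom 1 b * p) = Q * p" using sigma_mult_p by blast
    with E3 show ?thesis by (simp add: pop_E3 cyc_form_L2 op_L)
  next
    case (T a b)
    then show ?thesis by (simp add: cyc_form_T)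
  next
    case (U a b)
    let ?M = "monom (monom 1 a) b"
    have "cyc_form (pop opRx p (bas (U a b)))"
      by (rule cyc_formI[of _ 0 0 0 ?M 0 0]) (simp_all add: coord_pop_U)
    moreover have "cyc_form (opRs \<omega> (pop opRx p (bas (U a b))))"
      by (rule cyc_formI[of _ ?M 0 0 0 0 0]) (simp_all add: coord_pop_U coord_Rs coordE_pop_U)
    ultimately show ?thesis using U by simp
  qed
qed (simp_all add: popR.add popR.scale Rs.add Rs.scale cyc_form_add cyc_form_scale)

lemma cyc_form_ideal: "m \<in> cyc_ideal \<Longrightarrow> cyc_form m"
proof (induction rule: cyc_ideal.induct)
  case (left b P)
  show ?case
    by (rule cyc_formI[of _ 0 0 0 0 "monom P b" 0]) (simp_all add: coord_L smult_monom mult.commute)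
qed (simp_all add: cyc_form_right cyc_form_add)

text \<open>Small outer degree forces F1, F2 and then G to be multiples of p; each coordinate
  polynomial is then a multiple of p(x1) of too small an inner degree.\<close>

lemma cyc_ideal_low:
  assumes "m \<in> cyc_ideal"
    and low: "\<And>a b. Poly_Mapping.lookup m (E3 a b) \<noteq> 0 \<Longrightarrow> a < degree p \<and> b < degree p"
      "\<And>a b. Poly_Mapping.lookup m (T a b) \<noteq> 0 \<Longrightarrow> a < degree p \<and> b < degree p"
      "\<And>a b. Poly_Mapping.lookup m (U a b) \<noteq> 0 \<Longrightarrow> a < degree p \<and> b < degree p"
  shows "m = 0"
proof -
  have "cyc_form m" using cyc_form_ideal assms(1) by blast
  then obtain F1 F2 K1 K2 K3 G where m:
     "coordT m = smult p K1 + F1 * py + F2 * coordU kappa"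
     "coordU m = smult p K2 + F2 * py + F1 * coordU kappa"
     "coordE m = smult p K3 + G * py + smult (poly F1 neg_x) (coordE kappa)
       + smult (poly F2 neg_x) (coordE (opRs \<omega> kappa))"
    unfolding cyc_form_def by blast
  have inner: "coeff (coeff (coordT m) b) j = 0" "coeff (coeff (coordU m) b) j = 0" "coeff (coeff (coordE m) b) j = 0"
    if "j \<ge> degree p" for b j
    using low[of j b] that by (auto simp: coeff_coord)
  have outer: "coeff (coordT m) j = 0" "coeff (coordU m) j = 0" "coeff (coordE m) j = 0"
    if "j \<ge> degree p" for j
    using low[of _ j] that by (auto simp: coeff_coord poly_eq_iff)
  have deg_py: "degree py = degree p"
    unfolding py_def by (rule degree_map_poly) auto
  have py: "coeff py j = [:coeff p j:]" for j
    by (simp add: py_def coeff_map_poly)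
  have M: "degree M = degree p" "lead_coeff M = 1"
    if "M = py + D" "\<And>j. j \<ge> degree p \<Longrightarrow> coeff D j = 0" for M D
  proof -
    have "coeff M (degree p) = 1" using that monic by (simp add: py one_pCons)
    moreover have "degree M \<le> degree p"
      by (rule degree_le) (use that in \<open>auto simp: py coeff_eq_0\<close>)
    ultimately show "degree M = degree p"
      by (metis le_antisym le_degree zero_neq_one)
    with \<open>coeff M (degree p) = 1\<close> show "lead_coeff M = 1" by simp
  qed
  \<comment> \<open>Adding and subtracting the \<open>T\<close>- and \<open>U\<close>-coordinates decouples the two equations.\<close>
  let ?D = "coordU kappa"
  have "\<exists>G'. F1 + F2 = smult p G'"
  proof (rule monic_division_unique)
    show "lead_coeff (py + ?D) = 1" using M(2)[OF refl, of ?D] coordU_kappa by blast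
    show "(F1 + F2) * (py + ?D) + smult p (K1 + K2) = coordT m + coordU m"
      by (simp add: m algebra_simps smult_add_right)
    show "coeff (coordT m + coordU m) j = 0" if "degree (py + ?D) \<le> j" for j
      using that M(1)[OF refl, of ?D] coordU_kappa outer by simp
  qed
  moreover have "\<exists>G'. F1 - F2 = smult p G'"
  proof (rule monic_division_unique)
    have M': "degree (py - ?D) = degree p" "lead_coeff (py - ?D) = 1"
      using M[of "py - ?D" "- ?D"] coordU_kappa by auto
    then show "lead_coeff (py - ?D) = 1" by blast
    show "(F1 - F2) * (py - ?D) + smult p (K1 - K2) = coordT m - coordU m"
      by (simp add: m algebra_simps smult_diff_right)
    show "coeff (coordT m - coordU m) j = 0" if "degree (py - ?D) \<le> j" for j
      using that M' outer by simp
  qed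
  moreover obtain h :: 'a where h: "2 * h = 1" using two_unit by (metis dvdE)
  ultimately obtain A B where AB: "F1 + F2 = smult p A" "F1 - F2 = smult p B" by blast
  \<comment> \<open>Halving recovers F1 and F2 from their sum and difference.\<close>
  have hh: "smult [:h:] (P + P) = P" for P :: "'a poly poly"
  proof -
    have "smult [:h:] (P + P) = smult ([:h:] + [:h:]) P"
      by (simp only: smult_add_right smult_add_left)
    also have "[:h:] + [:h:] = [:2 * h:]" by simp
    finally have "smult [:h:] (P + P) = smult [:2 * h:] P" .
    then show ?thesis by (simp add: h flip: one_pCons)
  qed
  have "F1 = smult [:h:] ((F1 + F2) + (F1 - F2))" using hh[of F1] by simp
  then have F1: "F1 = smult p (smult [:h:] (A + B))"
    by (simp only: AB) (simp add: smult_add_right mult.commute)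
  have "F2 = smult [:h:] ((F1 + F2) - (F1 - F2))" using hh[of F2] by simp
  then have F2: "F2 = smult p (smult [:h:] (A - B))"
    by (simp only: AB) (simp add: smult_diff_right mult.commute)
  obtain F1' F2' where F: "F1 = smult p F1'" "F2 = smult p F2'" using F1 F2 by blast
  have T0: "coordT m = 0"
  proof -
    have "coordT m = smult p (K1 + F1' * py + F2' * ?D)"
      by (simp add: m F smult_add_right)
    then show ?thesis using monic_smult_low[OF monic] inner(1) by metis
  qed
  have U0: "coordU m = 0"
  proof -
    have "coordU m = smult p (K2 + F2' * py + F1' * ?D)"
      by (simp add: m F smult_add_right)
    then show ?thesis using monic_smult_low[OF monic] inner(2) by metis
  qed
  have E0: "coordE m = 0"
  proof -
    \<comment> \<open>Substituting -x1 for x2 keeps the factor p of F1 and F2, so their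
      contributions join the multiples of p and only G remains.\<close>
    define K where "K = K3 + smult (poly F1' neg_x) (coordE kappa) + smult (poly F2' neg_x) (coordE (opRs \<omega> kappa))"
    have m': "G * py + smult p K = coordE m"
      by (simp add: m F K_def smult_add_right algebra_simps)
    have "\<exists>G'. G = smult p G'"
      by (rule monic_division_unique[OF _ m']) (use M[of py 0] outer deg_py in auto)
    then obtain G' where "G = smult p G'" by blast
    with m' have "coordE m = smult p (G' * py + K)" by (simp add: smult_add_right)
    then show ?thesis using monic_smult_low[OF monic] inner(3) by metis
  qed
  show ?thesis by (rule coord_eq_0) fact+
qed

end

section \<open>Admissibility\<close>

definition cyc_poly :: "nat \<Rightarrow> (nat \<Rightarrow> 'a::comm_ring_1) \<Rightarrow> 'a poly" where
  "cyc_poly r u = (\<Prod>i = 1..r. [:- u i, 1:])"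

lemma sum_subsets_by_card:
  "(\<Sum>S\<in>Pow {1..r}. if card S = k then (\<Prod>i\<in>S. - u i) else 0) = (-1) ^ k * elem_sym r u k"
proof -
  have "(\<Sum>S\<in>Pow {1..r}. if card S = k then (\<Prod>i\<in>S. - u i) else 0)
      = (\<Sum>S | S \<subseteq> {1..r} \<and> card S = k. \<Prod>i\<in>S. - u i)"
    by (subst sum.inter_filter [symmetric]) (auto intro: sum.cong)
  also have "\<dots> = (\<Sum>S | S \<subseteq> {1..r} \<and> card S = k. (-1) ^ k * (\<Prod>i\<in>S. u i))"
    by (rule sum.cong) (auto simp: prod_uminus)
  finally show ?thesis by (simp add: elem_sym_def sum_distrib_left)
qed

lemma elem_sym_eq_0: "k > r \<Longrightarrow> elem_sym r u k = 0"
proof -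
  assume "k > r"
  have "card S \<le> r" if "S \<subseteq> {1..r}" for S
    using card_mono[OF _ that] by simp
  with \<open>k > r\<close> have "\<not> (S \<subseteq> {1..r} \<and> card S = k)" for S by (metis not_le)
  then have "{S. S \<subseteq> {1..r} \<and> card S = k} = {}" by blast
  then show ?thesis unfolding elem_sym_def by (simp only: sum.empty)
qed

lemma elem_sym_0: "elem_sym r u 0 = 1"
proof -
  have "{S. S \<subseteq> {1..r} \<and> card S = 0} = {{}}"
    by (auto dest: finite_subset)
  then show ?thesis unfolding elem_sym_def by simp
qed

lemma fps_prod_nth:
  "fps_nth (\<Prod>i = 1..r. 1 - fps_const (u i) * fps_X) k = (-1) ^ k * elem_sym r u k"
proof -
  have "(\<Prod>i = 1..r. 1 - fps_const (u i) * fps_X) = (\<Prod>i = 1..r. fps_const (- u i) * fps_X + 1)"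
    by (simp add: algebra_simps flip: fps_const_neg)
  also have "\<dots> = (\<Sum>S\<in>Pow {1..r}. (\<Prod>i\<in>S. fps_const (- u i) * fps_X) * (\<Prod>i\<in>{1..r} - S. 1))"
    by (rule prod_add) simp
  also have "\<dots> = (\<Sum>S\<in>Pow {1..r}. fps_const (\<Prod>i\<in>S. - u i) * fps_X ^ card S)"
  proof (rule sum.cong)
    fix S assume "S \<in> Pow {1..r}"
    have "(\<Prod>i\<in>S. fps_const (- u i)) = fps_const (\<Prod>i\<in>S. - u i)"
      by (induction S rule: infinite_finite_induct) (simp_all del: fps_const_neg)
    then show "(\<Prod>i\<in>S. fps_const (- u i) * fps_X) * (\<Prod>i\<in>{1..r} - S. 1)
        = fps_const (\<Prod>i\<in>S. - u i) * fps_X ^ card S"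
      by (simp add: prod.distrib del: fps_const_neg)
  qed simp
  also have "fps_nth \<dots> k = (\<Sum>S\<in>Pow {1..r}. if card S = k then (\<Prod>i\<in>S. - u i) else 0)"
    by (auto simp: fps_sum_nth fps_X_power_nth intro!: sum.cong)
  finally show ?thesis by (simp only: sum_subsets_by_card)
qed

lemma coeff_cyc_poly:
  "coeff (cyc_poly r u) j = (if j \<le> r then adm_coeff r u j else 0)"
proof -
  have "cyc_poly r u = (\<Prod>i = 1..r. [:- u i:] + monom 1 1)"
    by (simp add: cyc_poly_def monom_altdef)
  also have "\<dots> = (\<Sum>S\<in>Pow {1..r}. (\<Prod>i\<in>S. [:- u i:]) * (\<Prod>i\<in>{1..r} - S. monom 1 1))"
    by (rule prod_add) simp
  also have "\<dots> = (\<Sum>S\<in>Pow {1..r}. monom (\<Prod>i\<in>S. - u i) (r - card S))"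
  proof (rule sum.cong)
    fix S assume "S \<in> Pow {1..r}"
    then have S: "S \<subseteq> {1..r}" "finite S" by (auto dest: finite_subset)
    have "(\<Prod>i\<in>S. [:- u i:]) = [:\<Prod>i\<in>S. - u i:]"
      by (induction S rule: infinite_finite_induct) (simp_all add: one_pCons)
    moreover have "(\<Prod>i\<in>{1..r} - S. monom 1 1) = (monom 1 (r - card S) :: 'a poly)"
      using S by (simp add: card_Diff_subset monom_power)
    ultimately show "(\<Prod>i\<in>S. [:- u i:]) * (\<Prod>i\<in>{1..r} - S. monom 1 1) = monom (\<Prod>i\<in>S. - u i) (r - card S)"
      by (simp add: smult_monom)
  qed simp
  also have "coeff \<dots> j = (\<Sum>S\<in>Pow {1..r}. if j \<le> r \<and> card S = r - j then (\<Prod>i\<in>S. - u i) else 0)"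
    unfolding coeff_sum
  proof (rule sum.cong)
    fix S assume "S \<in> Pow {1..r}"
    then have "card S \<le> r" using card_mono[of "{1..r}" S] by simp
    then show "coeff (monom (\<Prod>i\<in>S. - u i) (r - card S)) j
        = (if j \<le> r \<and> card S = r - j then (\<Prod>i\<in>S. - u i) else 0)"
      by auto
  qed simp
  finally show ?thesis
    using sum_subsets_by_card[where r = r and k = "r - j" and u = u] by (cases "j \<le> r") (simp_all add: adm_coeff_def)
qed

lemma degree_cyc_poly: "degree (cyc_poly r u) = r" and monic_cyc_poly: "lead_coeff (cyc_poly r u) = 1"
proof -
  have 1: "coeff (cyc_poly r u) r = 1"
    by (simp add: coeff_cyc_poly adm_coeff_def elem_sym_0)
  moreover have "degree (cyc_poly r u) \<le> r"
    by (rule degree_le) (simp add: coeff_cyc_poly)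
  ultimately show "degree (cyc_poly r u) = r"
    by (metis le_antisym le_degree zero_neq_one)
  with 1 show "lead_coeff (cyc_poly r u) = 1" by simp
qed

text \<open>In each step of the recursion the new term -t^a either cancels the sign-flipped
  correction of the previous step or stands alone, which explains the parity condition at exponent a
  - 1.\<close>

lemma coeff_sig:
  "coeff (sig \<omega> a) j = of_bool (j = a) * (-1) ^ a
     + of_bool (j < a) * ((-1) ^ j * \<omega> (a - 1 - j) - of_bool (Suc j = a \<and> odd a))"
proof (induction a arbitrary: j)
  case 0
  show ?case by (simp add: one_pCons coeff_pCons split: nat.split)
next
  case (Suc a)
  show ?case
  proof (cases j)
    case 0
    then show ?thesis by (auto simp: monom_Suc)
  next
    case (Suc i)
    then show ?thesis by (auto simp: monom_Suc Suc.IH monom_0)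
  qed
qed

lemma coeff_sigma:
  assumes "degree P \<le> n"
  shows "coeff (sigma \<omega> P) j = (-1) ^ j * coeff P j
    + (-1) ^ j * (\<Sum>\<mu>\<le>n. \<omega> \<mu> * coeff P (\<mu> + j + 1)) - of_bool (even j) * coeff P (j + 1)"
proof -
  let ?f = "\<lambda>a. coeff P a * coeff (sig \<omega> a) j"
  \<comment> \<open>With this bound the substitution a = \<mu> + j + 1 lets \<mu> run up to n for
    every j.\<close>
  let ?N = "n + j + 1"
  have "coeff (sigma \<omega> P) j = (\<Sum>a\<le>?N. ?f a)"
    unfolding sigma_def by (subst smultmod.plin_superset[of _ ?N]) (use assms in \<open>auto simp: coeff_sum\<close>)
  also have "\<dots> = (\<Sum>a\<le>?N. if a = j then (-1) ^ j * coeff P j else 0)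
      + (\<Sum>a\<le>?N. of_bool (j < a) * ((-1) ^ j * \<omega> (a - 1 - j) * coeff P a))
      - (\<Sum>a\<le>?N. if a = j + 1 then of_bool (even j) * coeff P (j + 1) else 0)"
    unfolding sum.distrib [symmetric] sum_subtractf [symmetric]
  proof (rule sum.cong)
    fix a
    consider "a < j" | "a = j" | "a = Suc j" | "a > Suc j" by linarith
    then show "?f a = (if a = j then (-1) ^ j * coeff P j else 0)
        + of_bool (j < a) * ((-1) ^ j * \<omega> (a - 1 - j) * coeff P a)
        - (if a = j + 1 then of_bool (even j) * coeff P (j + 1) else 0)"
    proof cases
      case 1 then show ?thesis by (simp add: coeff_sig)
    next
      case 2 then show ?thesis by (simp add: coeff_sig mult.commute)
    next
      case 3
      have "coeff P (Suc j) * ((-1) ^ j * \<omega> 0 - of_bool (odd (Suc j)))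
          = (-1) ^ j * \<omega> 0 * coeff P (Suc j) - of_bool (even j) * coeff P (Suc j)"
        by (simp only: right_diff_distrib even_Suc not_not mult.commute)
      with 3 show ?thesis by (simp add: coeff_sig del: sig.simps)
    next
      case 4
      then have "coeff (sig \<omega> a) j = (-1) ^ j * \<omega> (a - 1 - j)" by (simp add: coeff_sig)
      with 4 show ?thesis by (simp add: mult.commute)
    qed
  qed simp
  also have "(\<Sum>a\<le>?N. of_bool (j < a) * ((-1) ^ j * \<omega> (a - 1 - j) * coeff P a))
      = (\<Sum>a = 0 + (j + 1)..n + (j + 1). (-1) ^ j * \<omega> (a - 1 - j) * coeff P a)"
    by (rule sum.mono_neutral_cong_right) auto
  also have "\<dots> = (\<Sum>\<mu>\<le>n. (-1) ^ j * \<omega> \<mu> * coeff P (\<mu> + j + 1))"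
    unfolding sum.shift_bounds_cl_nat_ivl by (simp add: atMost_atLeast0)
  finally show ?thesis by (simp add: sum_distrib_left mult.assoc)
qed

lemma omega_monom_mult: "omega \<omega> (monom 1 a * P) = (\<Sum>\<mu>\<le>degree P. coeff P \<mu> * \<omega> (\<mu> + a))"
proof -
  have "omega \<omega> (monom 1 a * P) = mulmod.plin (\<lambda>\<mu>. \<omega> (\<mu> + a)) P"
    by (induction P rule: poly_lin_induct)
       (simp_all add: mult_monom omega_monom mulmod.plin_monom distrib_left omega.add omega.scale
         mulmod.plin.add mulmod.plin.scale add.commute)
  then show ?thesis by (simp add: mulmod.plin_def)
qed

text \<open>Coefficients of t^j are compared after multiplication by (-1)^j. The term with -2 arises
  from (-1)^(r-j) = 1 - 2 [r - j odd], the term with a_(j+1) from the parity correction in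
  \<open>coeff_sig\<close>.\<close>

lemma admissible_iff:
  assumes "r \<ge> 1"
  shows "admissible r \<omega> u \<longleftrightarrow>
    sigma \<omega> (cyc_poly r u) = smult ((-1) ^ r) (cyc_poly r u) \<and>
    (\<forall>a. omega \<omega> (monom 1 a * cyc_poly r u) = 0)"
proof -
  let ?p = "cyc_poly r u" and ?a = "adm_coeff r u"
  have om: "omega \<omega> (monom 1 a * ?p) = (\<Sum>\<mu> = 0..r. ?a \<mu> * \<omega> (\<mu> + a))" for a
    unfolding omega_monom_mult degree_cyc_poly by (rule sum.cong) (auto simp: coeff_cyc_poly)
  have co: "coeff (sigma \<omega> ?p) j = (-1) ^ j * coeff ?p j
    + (-1) ^ j * (\<Sum>\<mu>\<le>r. \<omega> \<mu> * coeff ?p (\<mu> + j + 1)) - of_bool (even j) * coeff ?p (j + 1)" for j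
    by (rule coeff_sigma) (simp add: degree_cyc_poly)
  have high: "coeff (sigma \<omega> ?p) j = coeff (smult ((-1) ^ r) ?p) j" if "j \<ge> r" for j
    using that unfolding co by (auto simp: coeff_cyc_poly)
  have low: "coeff (sigma \<omega> ?p) j = coeff (smult ((-1) ^ r) ?p) j \<longleftrightarrow>
      (\<Sum>\<mu> = 0..r - j - 1. \<omega> \<mu> * ?a (\<mu> + j + 1))
        = - 2 * of_bool (odd (r - j)) * ?a j + of_bool (even j) * ?a (j + 1)" if "j < r" for j
  proof -
    have aux: "x + s - y = (1 - 2 * t) * x \<longleftrightarrow> s = - 2 * t * x + y" for x s y t :: 'a
    proof -
      have "x + s - y - (1 - 2 * t) * x = s - (- 2 * t * x + y)" by (simp add: algebra_simps)
      then show ?thesis by (metis eq_iff_diff_eq_0)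
    qed
    have S: "(\<Sum>\<mu>\<le>r. \<omega> \<mu> * coeff ?p (\<mu> + j + 1)) = (\<Sum>\<mu> = 0..r - j - 1. \<omega> \<mu> * ?a (\<mu> + j + 1))" (is "_ = ?S")
      by (rule sum.mono_neutral_cong_right) (use that in \<open>auto simp: coeff_cyc_poly\<close>)
    have "coeff (sigma \<omega> ?p) j = coeff (smult ((-1) ^ r) ?p) j \<longleftrightarrow>
        (-1) ^ j * coeff (sigma \<omega> ?p) j = (-1) ^ j * coeff (smult ((-1) ^ r) ?p) j"
      by (cases "even j") auto
    also have "(-1) ^ j * coeff (sigma \<omega> ?p) j = ?a j + ?S - of_bool (even j) * ?a (j + 1)"
      unfolding co S using that by (cases "even j") (auto simp: coeff_cyc_poly)
    also have "(-1) ^ j * coeff (smult ((-1) ^ r) ?p) j = (1 - 2 * of_bool (odd (r - j))) * ?a j"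
      using that by (cases "even j"; cases "even r") (auto simp: coeff_cyc_poly)
    finally show ?thesis unfolding aux .
  qed
  have "sigma \<omega> ?p = smult ((-1) ^ r) ?p \<longleftrightarrow> (\<forall>j<r. coeff (sigma \<omega> ?p) j = coeff (smult ((-1) ^ r) ?p) j)"
    unfolding poly_eq_iff using high by (meson not_less)
  also have "\<dots> \<longleftrightarrow> (\<forall>j\<in>{0..r - 1}. coeff (sigma \<omega> ?p) j = coeff (smult ((-1) ^ r) ?p) j)"
    using assms by auto
  also have "\<dots> \<longleftrightarrow> (\<forall>j\<in>{0..r - 1}. (\<Sum>\<mu> = 0..r - j - 1. \<omega> \<mu> * ?a (\<mu> + j + 1))
        = - 2 * of_bool (odd (r - j)) * ?a j + of_bool (even j) * ?a (j + 1))"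
  proof (rule ball_cong)
    fix j assume "j \<in> {0..r - 1}"
    then have "j < r" using assms by auto
    then show "coeff (sigma \<omega> ?p) j = coeff (smult ((-1) ^ r) ?p) j \<longleftrightarrow>
        (\<Sum>\<mu> = 0..r - j - 1. \<omega> \<mu> * ?a (\<mu> + j + 1))
          = - 2 * of_bool (odd (r - j)) * ?a j + of_bool (even j) * ?a (j + 1)"
      by (rule low)
  qed simp
  finally show ?thesis
    unfolding admissible_def om by (simp only:)
qed

text \<open>The leading term of sigma t^r is (-1)^r t^r. This dictates the scalar, and the
  difference only involves the first r powers, where independence applies.\<close>

lemma coeff_sigma_cyc_poly_high:
  "j \<ge> r \<Longrightarrow> coeff (sigma \<omega> (cyc_poly r u) - smult ((-1) ^ r) (cyc_poly r u)) j = 0"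
  using coeff_sigma[of "cyc_poly r u" r \<omega> j] by (auto simp: degree_cyc_poly coeff_cyc_poly)

section \<open>Generating functions and Schur q-functions\<close>

definition fps_neg_arg :: "'a::comm_ring_1 fps \<Rightarrow> 'a fps" where
  "fps_neg_arg f = Abs_fps (\<lambda>n. (-1) ^ n * fps_nth f n)"

lemma fps_neg_arg_nth [simp]: "fps_nth (fps_neg_arg f) n = (-1) ^ n * fps_nth f n"
  by (simp add: fps_neg_arg_def)

lemma fps_neg_arg_mult: "fps_neg_arg (f * g) = fps_neg_arg f * fps_neg_arg g"
proof (rule fps_ext)
  fix n
  have "(-1) ^ n * (fps_nth f i * fps_nth g (n - i))
      = ((-1) ^ i * fps_nth f i) * ((-1) ^ (n - i) * fps_nth g (n - i))" if "i \<le> n" for i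
  proof -
    have "(-1 :: 'a) ^ n = (-1) ^ i * (-1) ^ (n - i)" using that by (simp flip: power_add)
    then show ?thesis by (simp only: ac_simps)
  qed
  then show "fps_nth (fps_neg_arg (f * g)) n = fps_nth (fps_neg_arg f * fps_neg_arg g) n"
    by (simp add: fps_mult_nth sum_distrib_left)
qed

lemma fps_neg_arg_simps [simp]:
  "fps_neg_arg (f + g) = fps_neg_arg f + fps_neg_arg g"
  "fps_neg_arg (f - g) = fps_neg_arg f - fps_neg_arg g"
  "fps_neg_arg 1 = 1" "fps_neg_arg (fps_const c) = fps_const c" "fps_neg_arg fps_X = - fps_X"
  "fps_neg_arg (fps_neg_arg f) = f"
  by (auto simp: fps_eq_iff distrib_left right_diff_distrib fps_X_def simp flip: mult.assoc power_add)

text \<open>The reversal t^r p(1/t) of p, so that its k-th coefficient is a_(r-k).\<close>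

definition denom :: "nat \<Rightarrow> (nat \<Rightarrow> 'a::comm_ring_1) \<Rightarrow> 'a fps" where
  "denom r u = (\<Prod>i = 1..r. 1 - fps_const (u i) * fps_X)"

lemma fps_neg_arg_denom: "fps_neg_arg (denom r u) = (\<Prod>i = 1..r. 1 + fps_const (u i) * fps_X)"
  unfolding denom_def by (induction r) (simp_all add: fps_neg_arg_mult)

lemma schur_q_denom: "schur_q_gf r u * denom r u = fps_neg_arg (denom r u)"
  unfolding fps_neg_arg_denom unfolding denom_def by (rule schur_q_gf_eq)

lemma denom_inverse: "\<exists>g. denom r u * g = 1"
proof
  show "denom r u * (\<Prod>i = 1..r. Abs_fps (\<lambda>n. u i ^ n)) = 1"
    by (simp add: denom_def geometric_fps flip: prod.distrib)
qed

text \<open>The explicit inverse replaces an integral domain argument.\<close>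

lemma denom_cancel: "f * denom r u = g * denom r u \<longleftrightarrow> f = g"
proof
  obtain h where h: "denom r u * h = 1" using denom_inverse by blast
  assume "f * denom r u = g * denom r u"
  then have "f * (denom r u * h) = g * (denom r u * h)" by (metis mult.assoc)
  then show "f = g" by (simp add: h)
qed simp

text \<open>Q(t) = A(-t) / A(t) with A = \<open>denom r u\<close>, so replacing t by -t inverts
  Q.\<close>

lemma schur_q_gf_neg: "schur_q_gf r u * fps_neg_arg (schur_q_gf r u) = 1"
proof -
  let ?Q = "schur_q_gf r u" and ?A = "denom r u"
  have "(?Q * fps_neg_arg ?Q) * ?A = fps_neg_arg ?Q * (?Q * ?A)"
    by (simp only: ac_simps)
  also have "\<dots> = fps_neg_arg ?Q * fps_neg_arg ?A"
    by (simp only: schur_q_denom)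
  also have "\<dots> = fps_neg_arg (?Q * ?A)"
    by (simp only: fps_neg_arg_mult)
  also have "\<dots> = 1 * ?A"
    by (simp add: schur_q_denom)
  finally have "(?Q * fps_neg_arg ?Q) * ?A = 1 * ?A" .
  then show ?thesis by (simp only: denom_cancel)
qed

lemma schur_q_gf_0: "fps_nth (schur_q_gf r u) 0 = 1"
  by (simp add: schur_q_gf_def fps_prod_nth')

lemma fps_X_cancel: "fps_X * f = fps_X * g \<Longrightarrow> f = (g :: 'a::comm_ring_1 fps)"
proof (rule fps_ext)
  fix n assume "fps_X * f = fps_X * g"
  then have "fps_nth (fps_X * f) (Suc n) = fps_nth (fps_X * g) (Suc n)" by simp
  then show "fps_nth f n = fps_nth g n" by simp
qed

text \<open>The factor t absorbs the shift in q_(a+1), and the -1 removes q_0 = 1.\<close>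

lemma u_admissible_gf:
  "u_admissible r \<omega> u \<longleftrightarrow> fps_X * Abs_fps \<omega> = schur_q_gf r u - 1
     + fps_const (half * (-1) ^ (r - 1)) * (fps_X * schur_q_gf r u) + fps_const half * fps_X"
  (is "_ \<longleftrightarrow> ?l = ?r")
proof -
  have "fps_nth ?l n = fps_nth ?r n \<longleftrightarrow> (case n of 0 \<Rightarrow> True | Suc a \<Rightarrow>
      \<omega> a = schur_q r u (a + 1) + half * (-1) ^ (r - 1) * schur_q r u a + half * of_bool (a = 0))" for n
    by (cases n) (auto simp: schur_q_gf_0 schur_q_def fps_X_nth)
  then show ?thesis
    unfolding u_admissible_def fps_eq_iff by (auto split: nat.splits)
qed

lemma u_admissible_denom:
  "u_admissible r \<omega> u \<longleftrightarrow> fps_X * (Abs_fps \<omega> * denom r u) = fps_neg_arg (denom r u) - denom r u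
     + fps_const half * (fps_X * (fps_const ((-1) ^ (r - 1)) * fps_neg_arg (denom r u) + denom r u))"
proof -
  let ?Q = "schur_q_gf r u" and ?A = "denom r u" and ?h = "fps_const half"
  have "u_admissible r \<omega> u \<longleftrightarrow> fps_X * Abs_fps \<omega> * ?A
      = (?Q - 1 + fps_const (half * (-1) ^ (r - 1)) * (fps_X * ?Q) + ?h * fps_X) * ?A"
    unfolding u_admissible_gf denom_cancel ..
  also have "(?Q - 1 + fps_const (half * (-1) ^ (r - 1)) * (fps_X * ?Q) + ?h * fps_X) * ?A
      = ?Q * ?A - ?A + ?h * (fps_X * (fps_const ((-1) ^ (r - 1)) * (?Q * ?A) + ?A))"
    by (simp add: algebra_simps flip: fps_const_mult)
  finally show ?thesis by (simp add: schur_q_denom mult.assoc)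
qed

lemma denom_nth: "fps_nth (denom r u) k = (if k \<le> r then adm_coeff r u (r - k) else 0)"
  unfolding denom_def fps_prod_nth by (simp add: adm_coeff_def elem_sym_eq_0)

lemma u_admissible_coeffs:
  assumes "(2::'a::comm_ring_1) dvd 1" "r \<ge> 1"
  shows "u_admissible r \<omega> (u :: nat \<Rightarrow> 'a) \<longleftrightarrow>
    (\<forall>k. (\<Sum>\<mu>\<le>k. \<omega> \<mu> * fps_nth (denom r u) (k - \<mu>))
       = - 2 * of_bool (even k) * fps_nth (denom r u) (k + 1)
         + of_bool (even (r - 1 + k)) * fps_nth (denom r u) k)"
proof -
  let ?A = "fps_nth (denom r u)"
  have two: "half * (x + x) = x" for x :: 'a
    using two_mult_half[OF assms(1)] by (metis mult.assoc mult.commute mult_2 mult_1)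
  have "fps_nth (fps_X * (Abs_fps \<omega> * denom r u)) n = fps_nth (fps_neg_arg (denom r u) - denom r u
     + fps_const half * (fps_X * (fps_const ((-1) ^ (r - 1)) * fps_neg_arg (denom r u) + denom r u))) n \<longleftrightarrow>
    (case n of 0 \<Rightarrow> True | Suc k \<Rightarrow> (\<Sum>\<mu>\<le>k. \<omega> \<mu> * ?A (k - \<mu>))
       = - 2 * of_bool (even k) * ?A (k + 1) + of_bool (even (r - 1 + k)) * ?A k)" for n
  proof (cases n)
    case (Suc k)
    have "half * ((-1) ^ (r - 1) * ((-1) ^ k * ?A k) + ?A k) = of_bool (even (r - 1 + k)) * ?A k"
      using two[of "?A k"] by (cases "even (r - 1)"; cases "even k") simp_all
    moreover have "(-1) ^ Suc k * ?A (Suc k) - ?A (Suc k) = - 2 * of_bool (even k) * ?A (k + 1)"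
      by (cases "even k") simp_all
    moreover have "fps_nth (fps_X * (Abs_fps \<omega> * denom r u)) (Suc k) = (\<Sum>\<mu>\<le>k. \<omega> \<mu> * ?A (k - \<mu>))"
      by (simp add: fps_X_mult_nth fps_mult_nth[of "Abs_fps \<omega>"] atMost_atLeast0)
    moreover have "fps_nth (fps_neg_arg (denom r u) - denom r u
        + fps_const half * (fps_X * (fps_const ((-1) ^ (r - 1)) * fps_neg_arg (denom r u) + denom r u))) (Suc k)
      = (-1) ^ Suc k * ?A (Suc k) - ?A (Suc k) + half * ((-1) ^ (r - 1) * ((-1) ^ k * ?A k) + ?A k)"
      by (simp add: fps_X_mult_nth)
    ultimately show ?thesis
      unfolding Suc by (simp only: nat.case)
  qed simp
  then show ?thesis
    unfolding u_admissible_denom fps_eq_iff by (auto split: nat.splits)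
qed

lemma all_nat_split: "(\<forall>k. P k) \<longleftrightarrow> (\<forall>j\<in>{0..r - 1}. P (r - j - 1)) \<and> (\<forall>a. P (r + a))"
  if "r \<ge> 1" for r :: nat
proof (safe)
  fix k assume *: "\<forall>j\<in>{0..r - 1}. P (r - j - 1)" "\<forall>a. P (r + a)"
  show "P k"
  proof (cases "k < r")
    case True
    then have "P (r - (r - 1 - k) - 1)" by (intro bspec[OF *(1)]) auto
    with True show ?thesis by simp
  next
    case False
    with *(2)[rule_format, of "k - r"] show ?thesis by simp
  qed
qed auto

text \<open>In \<open>u_admissible_coeffs\<close> the index k = r - 1 - j gives the first family of
  admissibility equations and k = r + a the second.\<close>

lemma admissible_iff_u_admissible:
  assumes "(2::'a::comm_ring_1) dvd 1" "r \<ge> 1"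
  shows "admissible r \<omega> (u :: nat \<Rightarrow> 'a) \<longleftrightarrow> u_admissible r \<omega> u"
proof -
  let ?a = "adm_coeff r u"
  let ?P = "\<lambda>k. (\<Sum>\<mu>\<le>k. \<omega> \<mu> * fps_nth (denom r u) (k - \<mu>))
       = - 2 * of_bool (even k) * fps_nth (denom r u) (k + 1)
         + of_bool (even (r - 1 + k)) * fps_nth (denom r u) k"
  have low: "?P (r - j - 1) \<longleftrightarrow> (\<Sum>\<mu> = 0..r - j - 1. \<omega> \<mu> * ?a (\<mu> + j + 1))
        = - 2 * of_bool (odd (r - j)) * ?a j + of_bool (even j) * ?a (j + 1)" if j: "j \<in> {0..r - 1}" for j
  proof -
    from j assms(2) have jr: "j < r" by auto
    have "(\<Sum>\<mu>\<le>r - j - 1. \<omega> \<mu> * fps_nth (denom r u) (r - j - 1 - \<mu>))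
        = (\<Sum>\<mu> = 0..r - j - 1. \<omega> \<mu> * ?a (\<mu> + j + 1))"
    proof (rule sum.cong)
      fix \<mu> assume "\<mu> \<in> {0..r - j - 1}"
      then have "r - (r - j - 1 - \<mu>) = \<mu> + j + 1" using jr by auto
      then show "\<omega> \<mu> * fps_nth (denom r u) (r - j - 1 - \<mu>) = \<omega> \<mu> * ?a (\<mu> + j + 1)"
        by (simp add: denom_nth)
    qed auto
    moreover have "fps_nth (denom r u) (r - j - 1 + 1) = ?a j" "fps_nth (denom r u) (r - j - 1) = ?a (j + 1)"
      using jr by (simp_all add: denom_nth Suc_diff_Suc)
    moreover have "even (r - j - 1) \<longleftrightarrow> odd (r - j)" "even (r - 1 + (r - j - 1)) \<longleftrightarrow> even j"
      using jr by presburger+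
    ultimately show ?thesis by (simp only:)
  qed
  have high: "?P (r + a) \<longleftrightarrow> (\<Sum>\<mu> = 0..r. ?a \<mu> * \<omega> (\<mu> + a)) = 0" for a
  proof -
    have "(\<Sum>\<mu>\<le>r + a. \<omega> \<mu> * fps_nth (denom r u) (r + a - \<mu>)) = (\<Sum>\<mu> = 0 + a..r + a. \<omega> \<mu> * ?a (\<mu> - a))"
      by (rule sum.mono_neutral_cong_right) (auto simp: denom_nth)
    also have "\<dots> = (\<Sum>\<mu> = 0..r. ?a \<mu> * \<omega> (\<mu> + a))"
      unfolding sum.shift_bounds_cl_nat_ivl by (simp add: mult.commute)
    \<comment> \<open>For k = r the k-th coefficient of \<open>denom\<close> need not vanish, but
      its factor does, as r - 1 + r is odd; beyond r all coefficients are 0.\<close>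
    finally show ?thesis
      using assms(2) by (cases "a = 0") (auto simp: denom_nth)
  qed
  have "u_admissible r \<omega> u \<longleftrightarrow> (\<forall>k. ?P k)" by (rule u_admissible_coeffs[OF assms])
  also have "\<dots> \<longleftrightarrow> (\<forall>j\<in>{0..r - 1}. ?P (r - j - 1)) \<and> (\<forall>a. ?P (r + a))"
    by (rule all_nat_split[OF assms(2)])
  also have "\<dots> \<longleftrightarrow> admissible r \<omega> u"
    unfolding admissible_def using low high by simp
  finally show ?thesis by simp
qed

text \<open>The quadratic relations are the coefficients of Z(t) Z(-t) = 1 - t^2/4 for Z = 1 + t
  Om(t) - t/2. By u-admissibility Z = Q(t) (1 + eps t/2) with eps^2 = 1, and the identity follows
  from Q(t) Q(-t) = 1.\<close>

lemma omega_sig_u_admissible: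
  assumes "(2::'a::comm_ring_1) dvd 1" and u: "u_admissible r \<omega> (u :: nat \<Rightarrow> 'a)"
  shows "omega \<omega> (sig \<omega> a) = \<omega> a"
proof -
  define h where "h = (fps_const half :: 'a fps)"
  define Om where "Om = Abs_fps \<omega>"
  define Q where "Q = schur_q_gf r u"
  define eps where "eps = fps_const ((-1 :: 'a) ^ (r - 1))"
  define Z where "Z = fps_X * Om + 1 - h * fps_X"
  have eps: "eps * eps = 1"
    by (simp add: eps_def flip: power_add)
  have Z: "Z = Q * (1 + eps * h * fps_X)"
    using u unfolding u_admissible_gf Z_def Om_def[symmetric] Q_def[symmetric] h_def[symmetric]
    by (simp add: eps_def h_def algebra_simps flip: fps_const_mult)
  then have "fps_neg_arg Z = fps_neg_arg Q * (1 - eps * h * fps_X)"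
    by (simp add: fps_neg_arg_mult eps_def h_def)
  with Z have "Z * fps_neg_arg Z = (Q * fps_neg_arg Q) * ((1 + eps * h * fps_X) * (1 - eps * h * fps_X))"
    by (simp only: ac_simps)
  also have "\<dots> = 1 - eps * eps * (h * h * fps_X * fps_X)"
    unfolding Q_def schur_q_gf_neg by (simp add: algebra_simps)
  finally have ZZ: "Z * fps_neg_arg Z = 1 - h * h * fps_X * fps_X"
    by (simp add: eps)
  have neg_Z: "fps_neg_arg Z = 1 + h * fps_X - fps_X * fps_neg_arg Om"
    by (simp add: Z_def fps_neg_arg_mult h_def)
  have "Z * fps_neg_arg Z = 1 - h * h * fps_X * fps_X
      + fps_X * (Om - (fps_neg_arg Om + fps_X * Om * fps_neg_arg Om - h * (fps_X * (Om + fps_neg_arg Om))))"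
    unfolding neg_Z unfolding Z_def by (simp add: algebra_simps)
  then have "fps_X * (Om - (fps_neg_arg Om + fps_X * Om * fps_neg_arg Om - h * (fps_X * (Om + fps_neg_arg Om)))) = fps_X * 0"
    using ZZ by simp
  from fps_X_cancel[OF this]
  have main: "Om = fps_neg_arg Om + fps_X * (Om * fps_neg_arg Om) - h * (fps_X * (Om + fps_neg_arg Om))"
    by (simp add: mult.assoc)
  have two: "half * (x + x) = x" for x :: 'a
    using two_mult_half[OF assms(1)] by (metis mult.assoc mult.commute mult_2 mult_1)
  have om: "omega \<omega> (sig \<omega> a) = (\<Sum>i\<le>a. coeff (sig \<omega> a) i * \<omega> i)"
    unfolding omega_def by (rule mulmod.plin_superset, rule degree_le) (simp add: coeff_sig)
  show ?thesis
  proof (cases a)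
    case 0
    then show ?thesis unfolding om by simp
  next
    case (Suc b)
    have "omega \<omega> (sig \<omega> a) = (-1) ^ Suc b * \<omega> (Suc b) + (\<Sum>i\<le>b. (-1) ^ i * \<omega> (b - i) * \<omega> i) - of_bool (even b) * \<omega> b"
    proof -
      have "(\<Sum>i\<le>b. coeff (sig \<omega> (Suc b)) i * \<omega> i)
          = (\<Sum>i\<le>b. (-1) ^ i * \<omega> (b - i) * \<omega> i - (if i = b then of_bool (even b) * \<omega> b else 0))"
        by (rule sum.cong) (auto simp: coeff_sig left_diff_distrib simp del: sig.simps)
      then show ?thesis
        using om unfolding Suc by (simp add: sum_subtractf coeff_sig del: sig.simps)
    qed
    also have "(\<Sum>i\<le>b. (-1) ^ i * \<omega> (b - i) * \<omega> i) = fps_nth (fps_neg_arg Om * Om) b"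
      unfolding fps_mult_nth Om_def fps_neg_arg_nth fps_nth_Abs_fps atMost_atLeast0
      by (simp only: mult.assoc mult.commute[of "\<omega> (b - _)"])
    also have "of_bool (even b) * \<omega> b = half * (\<omega> b + (-1) ^ b * \<omega> b)"
      using two[of "\<omega> b"] by (cases "even b") auto
    also have "(-1) ^ Suc b * \<omega> (Suc b) + fps_nth (fps_neg_arg Om * Om) b - half * (\<omega> b + (-1) ^ b * \<omega> b) = \<omega> (Suc b)"
    proof -
      have "fps_nth Om (Suc b) = fps_nth (fps_neg_arg Om) (Suc b) + fps_nth (Om * fps_neg_arg Om) b
          - half * (fps_nth Om b + fps_nth (fps_neg_arg Om) b)"
        by (subst main) (simp add: h_def fps_X_mult_nth)
      then show ?thesis by (simp add: Om_def mult.commute[of "fps_neg_arg _"])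
    qed
    finally show ?thesis using Suc by simp
  qed
qed

section \<open>Computations in the presented algebra\<close>

interpretation fa: lmod "\<lambda>(c :: 'a::comm_ring_1) (f :: ('g, 'a) free_alg). scalar c * f"
  by unfold_locales (simp_all add: distrib_left distrib_right mult.assoc)

declare fa.scale_scale [simp del]

abbreviation gS :: "(dcbmw_gen, 'a::comm_ring_1) free_alg" where "gS \<equiv> gen S1"
abbreviation gE :: "(dcbmw_gen, 'a::comm_ring_1) free_alg" where "gE \<equiv> gen E1"
abbreviation gX :: "(dcbmw_gen, 'a::comm_ring_1) free_alg" where "gX \<equiv> gen X1"
abbreviation gY :: "(dcbmw_gen, 'a::comm_ring_1) free_alg" where "gY \<equiv> gen X2"

definition ev :: "'a::comm_ring_1 poly \<Rightarrow> (dcbmw_gen, 'a) free_alg" where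
  "ev P = fa.plin (\<lambda>i. gX ^ i) P"

global_interpretation ev: lhom smult "\<lambda>c f. scalar c * f" ev
  unfolding ev_def by (rule fa.hom_plin)

lemma ev_monom: "ev (monom 1 i) = gX ^ i"
  by (simp add: ev_def fa.plin_monom)

lemma scalar_left_commute: "f * (scalar c * g) = scalar c * (f * g)"
  by (metis mult.assoc scalar_comm)

lemma ev_x: "ev (monom 1 1 * P) = gX * ev P"
  by (induction P rule: poly_lin_induct)
     (simp_all add: mult_monom ev_monom distrib_left ev.add ev.scale scalar_left_commute)

lemma ev_comm: "gX * ev P = ev P * gX"
  by (induction P rule: poly_lin_induct)
     (simp_all add: ev_monom distrib_left distrib_right ev.add ev.scale scalar_left_commute mult.assoc
       power_commutes)

lemma ev_1 [simp]: "ev 1 = 1"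
  using ev_monom[of 0] by simp

lemma ev_const: "ev [:c:] = scalar c"
  using ev.scale[of c 1] by simp

lemma ev_linear_factor: "ev (P * [:- c, 1:]) = ev P * (gX - scalar c)"
proof -
  have "P * [:- c, 1:] = monom 1 1 * P - smult c P"
    by (simp add: monom_altdef mult.commute)
  then show ?thesis
    by (simp add: ev.diff ev.scale ev_x [simplified] ev_comm right_diff_distrib scalar_comm)
qed

lemma ev_cyc_poly: "prod_list (map (\<lambda>i. gX - scalar (u i)) [1..<Suc r]) = ev (cyc_poly r u)"
proof (induction r)
  case 0
  show ?case using ev_monom[of 0] by (simp add: cyc_poly_def)
next
  case (Suc r)
  have "cyc_poly (Suc r) u = cyc_poly r u * [:- u (Suc r), 1:]"
    by (simp add: cyc_poly_def)
  moreover have "[1..<Suc (Suc r)] = [1..<Suc r] @ [Suc r]" by simp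
  ultimately show ?case using Suc by (simp only: ev_linear_factor map_append prod_list.append) simp
qed

context
  fixes r :: nat and \<omega> u :: "nat \<Rightarrow> 'a::comm_ring_1"
begin

abbreviation J where "J \<equiv> dcbmw_ideal r \<omega> u"

lemma J_mult_left: "f \<in> J \<Longrightarrow> g * f \<in> J" and J_mult_right: "f \<in> J \<Longrightarrow> f * g \<in> J"
  and J_add: "f \<in> J \<Longrightarrow> g \<in> J \<Longrightarrow> f + g \<in> J" and J_0: "0 \<in> J"
proof -
  interpret ideal J ring_of_type_algebra by (rule ideal_dcbmw_ideal)
  show "f \<in> J \<Longrightarrow> g * f \<in> J" using I_l_closed[of f g] by simp
  show "f \<in> J \<Longrightarrow> f * g \<in> J" using I_r_closed[of f g] by simp
  show "f \<in> J \<Longrightarrow> g \<in> J \<Longrightarrow> f + g \<in> J" 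
    using additive_subgroup.a_closed[OF additive_subgroup_axioms, of f g] by simp
  show "0 \<in> J" using additive_subgroup.zero_closed[OF additive_subgroup_axioms] by simp
qed

lemma J_uminus: "f \<in> J \<Longrightarrow> - f \<in> J"
  using J_mult_left[of f "- 1"] by simp

lemma J_diff: "f \<in> J \<Longrightarrow> g \<in> J \<Longrightarrow> f - g \<in> J"
  using J_add[of f "- g"] J_uminus[of g] by simp

lemma J_relator: "f \<in> dcbmw_relators r \<omega> u \<Longrightarrow> f \<in> J"
  unfolding dcbmw_ideal_def using ring.genideal_self[OF ring_ring_of_type_algebra, of "dcbmw_relators r \<omega> u"]
  by auto

lemma J_relations:
  "gX * gY - gY * gX \<in> J" "(gS * gX - gY * gS) - (gE - 1) \<in> J" "gS * gE - gE \<in> J"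
  "(gX + gY) * gE \<in> J" "gE * gE - scalar (\<omega> 0) * gE \<in> J" "ev (cyc_poly r u) \<in> J"
  "a > 0 \<Longrightarrow> gE * gX ^ a * gE - scalar (\<omega> a) * gE \<in> J"
  by (rule J_relator; unfold dcbmw_relators_def Let_def ev_cyc_poly; blast)+

lemma omega_1 [simp]: "omega \<omega> 1 = \<omega> 0"
  using omega_monom[of \<omega> 1 0] by simp

lemma e_ev_e: "gE * ev P * gE - scalar (omega \<omega> P) * gE \<in> J"
proof (induction P rule: poly_lin_induct)
  case (monom i)
  show ?case
    using J_relations(5) J_relations(7)[of i] by (cases "i = 0") (simp_all add: ev_monom omega_monom)
next
  case (add P Q)
  then show ?case using J_add[OF add] by (simp add: ev.add omega.add algebra_simps)
next
  case (scale c P)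
  have "gE * ev (smult c P) * gE = scalar c * (gE * ev P * gE)"
    by (simp add: ev.scale scalar_left_commute mult.assoc)
  with J_mult_left[OF scale, of "scalar c"] show ?case
    by (simp add: omega.scale right_diff_distrib mult.assoc)
qed

lemma xy_ev_e: "(gX + gY) * ev P * gE \<in> J"
proof (induction P rule: poly_lin_induct)
  case (monom i)
  show ?case
  proof (induction i)
    case 0
    then show ?case using J_relations(4) by simp
  next
    case (Suc i)
    have "gX * ((gX + gY) * ev (monom 1 i) * gE) - (gX * gY - gY * gX) * (gX ^ i * gE) \<in> J"
      by (rule J_diff[OF J_mult_left[OF Suc] J_mult_right[OF J_relations(1)]])
    then show ?case by (simp add: ev_monom algebra_simps)
  qed
next
  case (add P Q)
  then show ?case using J_add[OF add] by (simp add: ev.add algebra_simps)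
next
  case (scale c P)
  from J_mult_left[OF scale, of "scalar c"] show ?case
    by (simp add: ev.scale scalar_left_commute mult.assoc)
qed

lemma s_ev_e: "gS * ev P * gE - ev (sigma \<omega> P) * gE \<in> J"
proof (induction P rule: poly_lin_induct)
  case (monom i)
  show ?case
  proof (induction i)
    case 0
    show ?case using J_relations(3) by simp
  next
    case (Suc i)
    let ?P = "monom 1 i :: 'a poly" and ?s = "sigma \<omega> (monom 1 i)"
    have m: "monom (1::'a) (Suc i) = monom 1 1 * ?P" by (simp add: mult_monom)
    \<comment> \<open>The summands stand for moving s1 past x1, the induction hypothesis, x2 = -x1
      in front of e1, and e1 P(x1) e1 = omega(P) e1; they add up to the claim for t^(i+1).\<close>
    have "((gS * gX - gY * gS) - (gE - 1)) * (ev ?P * gE) + gY * (gS * ev ?P * gE - ev ?s * gE)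
        + (gX + gY) * ev ?s * gE + (gE * ev ?P * gE - scalar (omega \<omega> ?P) * gE) \<in> J"
      by (rule J_add[OF J_add[OF J_add[OF J_mult_right[OF J_relations(2)] J_mult_left[OF Suc]] xy_ev_e] e_ev_e])
    then show ?case
      unfolding m sigma_x ev.diff ev_x ev_const by (simp add: algebra_simps)
  qed
next
  case (add P Q)
  then show ?case using J_add[OF add] by (simp add: ev.add sigma.add algebra_simps)
next
  case (scale c P)
  from J_mult_left[OF scale, of "scalar c"] show ?case
    by (simp add: ev.scale sigma.scale right_diff_distrib scalar_left_commute mult.assoc)
qed

lemma admissible_if_indep:
  assumes "r \<ge> 1"
    and indep: "\<And>P. (\<And>j. j \<ge> r \<Longrightarrow> coeff P j = 0) \<Longrightarrow> ev P * gE \<in> J \<Longrightarrow> P = 0"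
  shows "admissible r \<omega> u"
  unfolding admissible_iff[OF assms(1)]
proof (intro conjI allI)
  let ?p = "cyc_poly r u"
  have "gS * ev ?p * gE \<in> J" "ev ?p * gE \<in> J"
    by (rule J_mult_right[OF J_mult_left[OF J_relations(6)]], rule J_mult_right[OF J_relations(6)])
  then have "gS * ev ?p * gE - (gS * ev ?p * gE - ev (sigma \<omega> ?p) * gE) - scalar ((-1) ^ r) * (ev ?p * gE) \<in> J"
    by (rule J_diff[OF J_diff[OF _ s_ev_e] J_mult_left])
  then have "ev (sigma \<omega> ?p - smult ((-1) ^ r) ?p) * gE \<in> J"
    by (simp add: ev.diff ev.scale left_diff_distrib mult.assoc)
  from indep[OF coeff_sigma_cyc_poly_high this]
  show "sigma \<omega> ?p = smult ((-1) ^ r) ?p" by simp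
  fix a
  have "ev (monom 1 a * ?p) = gX ^ a * ev ?p"
  proof (induction a)
    case 0 show ?case by (simp flip: one_pCons)
  next
    case (Suc a)
    have "monom 1 (Suc a) * ?p = monom 1 1 * (monom 1 a * ?p)"
      by (simp add: mult_monom flip: mult.assoc)
    then show ?case by (simp only: ev_x Suc) (simp add: mult.assoc)
  qed
  then have "gE * ev (monom 1 a * ?p) * gE \<in> J"
    by (simp only:) (rule J_mult_right[OF J_mult_left[OF J_mult_left[OF J_relations(6)]]])
  from J_diff[OF this e_ev_e[of "monom 1 a * ?p"]]
  have "ev [:omega \<omega> (monom 1 a * ?p):] * gE \<in> J" by (simp add: ev_const)
  \<comment> \<open>A constant lies in the independent range because r >= 1.\<close>
  moreover have "coeff [:omega \<omega> (monom 1 a * ?p):] j = 0" if "j \<ge> r" for j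
    using that assms(1) by (cases j) auto
  ultimately have "[:omega \<omega> (monom 1 a * ?p):] = 0" using indep by blast
  then show "omega \<omega> (monom 1 a * ?p) = 0" by simp
qed

end

section \<open>The action of the free algebra\<close>

primrec act_gen :: "(nat \<Rightarrow> 'a::comm_ring_1) \<Rightarrow> dcbmw_gen \<Rightarrow> (idx \<Rightarrow>\<^sub>0 'a) \<Rightarrow> (idx \<Rightarrow>\<^sub>0 'a)" where
  "act_gen \<omega> S1 = opS \<omega>"
| "act_gen \<omega> E1 = opE \<omega>"
| "act_gen \<omega> X1 = opX"
| "act_gen \<omega> X2 = opY"

definition act_word :: "(nat \<Rightarrow> 'a::comm_ring_1) \<Rightarrow> dcbmw_gen word \<Rightarrow> (idx \<Rightarrow>\<^sub>0 'a) \<Rightarrow> (idx \<Rightarrow>\<^sub>0 'a)" where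
  "act_word \<omega> w m = foldr (act_gen \<omega>) (letters w) m"

definition act :: "(nat \<Rightarrow> 'a::comm_ring_1) \<Rightarrow> (dcbmw_gen, 'a) free_alg \<Rightarrow> (idx \<Rightarrow>\<^sub>0 'a) \<Rightarrow> (idx \<Rightarrow>\<^sub>0 'a)" where
  "act \<omega> f m = pm.lext (\<lambda>w. act_word \<omega> w m) f"

interpretation act: lhom pm_scale pm_scale "\<lambda>f. act \<omega> f m" for \<omega> :: "nat \<Rightarrow> 'a::comm_ring_1" and m
  unfolding act_def by (rule pm.hom_lext)

lemma scalar_mult_eq: "scalar c * f = pm_scale c f"
  by (simp add: scalar_def pm_scale_def mult_map_scale_conv_mult)

lemma act_gen_linear: "lhom pm_scale pm_scale (act_gen \<omega> g)"
  by (cases g) (simp_all add: S.lhom_axioms E.lhom_axioms X.lhom_axioms Y.lhom_axioms)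

interpretation act_word: lhom pm_scale pm_scale "act_word \<omega> w" for \<omega> :: "nat \<Rightarrow> 'a::comm_ring_1" and w
proof unfold_locales
  interpret lhom pm_scale pm_scale "act_gen \<omega> g" for g by (rule act_gen_linear)
  have "foldr (act_gen \<omega>) gs (m + n) = foldr (act_gen \<omega>) gs m + foldr (act_gen \<omega>) gs n"
    "foldr (act_gen \<omega>) gs (pm_scale c m) = pm_scale c (foldr (act_gen \<omega>) gs m)" for gs m n c
    by (induction gs) (simp_all add: add scale)
  then show "act_word \<omega> w (m + n) = act_word \<omega> w m + act_word \<omega> w n"
    "act_word \<omega> w (pm_scale c m) = pm_scale c (act_word \<omega> w m)" for m n c
    by (simp_all add: act_word_def)
qed

lemma act_bas [simp]: "act \<omega> (bas w) m = act_word \<omega> w m"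
  by (simp add: act_def)

lemma bas_mult: "bas v * bas w = (bas (v + w) :: ('g, 'a::comm_ring_1) free_alg)"
  by (simp add: bas_def mult_single)

lemma act_word_add: "act_word \<omega> (v + w) m = act_word \<omega> v (act_word \<omega> w m)"
  by (simp add: act_word_def plus_word_def)

lemma act_mult: "act \<omega> (f * g) m = act \<omega> f (act \<omega> g m)"
proof (induction f rule: pm_induct)
  case (bas v)
  show ?case
  proof (induction g rule: pm_induct)
    case (scale c g)
    have "bas v * pm_scale c g = pm_scale c (bas v * g)"
      by (metis scalar_left_commute scalar_mult_eq)
    with scale show ?case by (simp add: act.scale act_word.scale)
  qed (simp_all add: bas_mult act_word_add distrib_left act.add act_word.add)
next
  case (scale c f)
  have "pm_scale c f * g = pm_scale c (f * g)"
    by (metis mult.assoc scalar_mult_eq)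
  with scale show ?case by (simp add: act.scale)
qed (simp_all add: distrib_right act.add)

lemma act_gen: "act \<omega> (gen g) m = act_gen \<omega> g m"
  unfolding gen_def bas_def [symmetric] by (simp add: act_word_def)

lemma act_1: "act \<omega> 1 m = m"
  unfolding single_one [symmetric] bas_def [symmetric] by (simp add: act_word_def zero_word_def)

lemma act_scalar: "act \<omega> (scalar c * f) m = pm_scale c (act \<omega> f m)"
  by (simp add: scalar_mult_eq act.scale)

lemma act_scalar_id: "act \<omega> (scalar c) m = pm_scale c m"
  using act_scalar[of \<omega> c 1 m] by (simp add: act_1)

lemma act_power: "act \<omega> (f ^ k) m = (act \<omega> f ^^ k) m"
  by (induction k) (simp_all add: act_1 act_mult)

lemma act_X_power: "act \<omega> (gX ^ k) m = (opX ^^ k) m"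
  unfolding act_power by (rule arg_cong[of _ _ "\<lambda>F. (F ^^ k) m"]) (simp add: fun_eq_iff act_gen)

lemma act_ev: "act \<omega> (ev P) m = pop opX P m"
proof -
  have "act \<omega> (ev P) m = pm.plin (\<lambda>i. act \<omega> (gX ^ i) m) P"
    by (simp add: ev_def fa.plin_def pm.plin_def act.sum act_scalar)
  then show ?thesis by (simp add: pop_def act_X_power)
qed

lemmas act_simps = act_mult act_gen act.add act.diff act_scalar_id act_1 act_X_power act_ev

context cyc_params
begin

lemma act_cyc_ideal: "m \<in> cyc_ideal \<Longrightarrow> act \<omega> f m \<in> cyc_ideal"
proof (induction f rule: pm_induct)
  case (bas w)
  have "foldr (act_gen \<omega>) gs m \<in> cyc_ideal" for gs
  proof (induction gs)
    case (Cons g gs)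
    then show ?case
      by (cases g) (simp_all add: cyc_ideal_S cyc_ideal_E cyc_ideal_X cyc_ideal_Y)
  qed (simp add: bas)
  then show ?case by (simp add: act_word_def)
qed (simp_all add: act.add act.scale cyc_ideal_scale cyc_ideal.add)

text \<open>The annihilator of the quotient module by \<open>cyc_ideal\<close>. Being a two-sided
  ideal, it contains the ideal of relations once it contains the relators.\<close>

definition ann :: "(dcbmw_gen, 'a) free_alg set" where
  "ann = {f. \<forall>m. act \<omega> f m \<in> cyc_ideal}"

lemma ideal_ann: "ideal ann ring_of_type_algebra"
proof (rule idealI[OF ring_ring_of_type_algebra])
  show "subgroup ann (add_monoid ring_of_type_algebra)"
  proof (rule group.subgroupI)
    show "Group.group (add_monoid (ring_of_type_algebra :: (dcbmw_gen, 'a) free_alg ring))"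
      by (rule abelian_group.a_group[OF ring.is_abelian_group[OF ring_ring_of_type_algebra]])
    show "ann \<noteq> {}"
      by (auto simp: ann_def intro!: exI[of _ 0] cyc_ideal_zero)
    show "inv\<^bsub>add_monoid ring_of_type_algebra\<^esub> f \<in> ann" if "f \<in> ann" for f
    proof -
      interpret ring "ring_of_type_algebra :: (dcbmw_gen, 'a) free_alg ring"
        by (rule ring_ring_of_type_algebra)
      have "inv\<^bsub>add_monoid ring_of_type_algebra\<^esub> f = - f"
        using minus_equality[of "- f" f] by (simp add: a_inv_def)
      moreover have "- m \<in> cyc_ideal" if "m \<in> cyc_ideal" for m
        using cyc_ideal_scale[OF that, of "- 1"] by simp
      ultimately show ?thesis using \<open>f \<in> ann\<close> by (simp add: ann_def act.neg)
    qed
  qed (auto simp: ann_def act.add cyc_ideal.add)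
qed (auto simp: ann_def act_mult act_cyc_ideal)

lemma dcbmw_ideal_subset_ann:
  assumes "p = cyc_poly r u"
  shows "dcbmw_ideal r \<omega> u \<subseteq> ann"
  unfolding dcbmw_ideal_def
proof (rule ring.genideal_minimal[OF ring_ring_of_type_algebra ideal_ann])
  have EE: "opE \<omega> (opE \<omega> m) = pm_scale (\<omega> 0) (opE \<omega> m)" for m
    using EXE[of \<omega> 0 m] by simp
  have "prod_list (map (\<lambda>i. gX - scalar (u i)) [1..<Suc r]) \<in> ann"
    unfolding ev_cyc_poly assms[symmetric] ann_def by (simp add: act_ev pop_X_in_cyc_ideal)
  moreover have "gE * gE - scalar (\<omega> 0) * gE \<in> ann" "gE * gX ^ a * gE - scalar (\<omega> a) * gE \<in> ann" for a
    by (simp_all add: ann_def act_simps EE EXE cyc_ideal_zero)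
  moreover have "f \<in> ann" if "\<And>m. act \<omega> f m = 0" for f
    using that by (simp add: ann_def cyc_ideal_zero)
  ultimately show "dcbmw_relators r \<omega> u \<subseteq> ann"
    unfolding dcbmw_relators_def Let_def
    by (auto simp: act_simps XY SS EE EXE SX SE ES YE EY SY op_linear)
qed

end

section \<open>Independence of the large family by evaluation at 1\<close>

definition basis_elt :: "nat \<times> nat + nat \<times> nat + nat \<times> nat \<Rightarrow> (dcbmw_gen, 'a::comm_ring_1) free_alg" where
  "basis_elt = case_sum (\<lambda>(a, b). gX ^ a * gE * gX ^ b)
     (case_sum (\<lambda>(a, b). gX ^ a * gY ^ b * gS) (\<lambda>(a, b). gX ^ a * gY ^ b))"

definition basis_idx :: "nat \<times> nat + nat \<times> nat + nat \<times> nat \<Rightarrow> idx" where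
  "basis_idx = case_sum (\<lambda>(a, b). E3 a b) (case_sum (\<lambda>(a, b). T a b) (\<lambda>(a, b). U a b))"

lemma inj_basis_idx: "inj basis_idx"
  by (auto simp: inj_def basis_idx_def split: sum.splits)

lemma act_basis_elt: "act \<omega> (basis_elt i) (bas (U 0 0)) = bas (basis_idx i)"
proof -
  have Y: "act \<omega> (gY ^ b) (bas (U 0 0)) = bas (U 0 b)" "act \<omega> (gY ^ b) (bas (T 0 0)) = bas (T 0 b)" for b
    by (induction b) (simp_all add: act_simps)
  show ?thesis
    by (auto simp: basis_elt_def basis_idx_def act_simps Y Xk_U Xk_T Xk_E3 split: sum.split)
qed

lemma (in cyc_params) basis_elt_indep:
  assumes p: "p = cyc_poly r u" and "finite K"
    and K: "K \<subseteq> ({0..<r} \<times> {0..<r}) <+> ({0..<r} \<times> {0..<r}) <+> ({0..<r} \<times> {0..<r})"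
    and "(\<Sum>i\<in>K. scalar (k i) * basis_elt i) \<in> dcbmw_ideal r \<omega> u" "i \<in> K"
  shows "k i = 0"
proof -
  define m where "m = (\<Sum>i\<in>K. pm_scale (k i) (bas (basis_idx i)))"
  have "act \<omega> (\<Sum>i\<in>K. scalar (k i) * basis_elt i) (bas (U 0 0)) = m"
    by (simp add: m_def act.sum act_scalar act_basis_elt)
  with assms(4) dcbmw_ideal_subset_ann[OF p] have "m \<in> cyc_ideal"
    by (auto simp: ann_def)
  have lookup: "Poly_Mapping.lookup m j = (\<Sum>i\<in>K. if basis_idx i = j then k i else 0)" for j
    unfolding m_def lookup_sum by (rule sum.cong) (auto simp: lookup_bas)
  have ex: "\<exists>i\<in>K. basis_idx i = j" if "Poly_Mapping.lookup m j \<noteq> 0" for j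
    using that unfolding lookup
    by (rule sum.not_neutral_contains_not_neutral) (auto split: if_splits)
  have idx: "case basis_idx i of E3 a b \<Rightarrow> a < r \<and> b < r | T a b \<Rightarrow> a < r \<and> b < r | U a b \<Rightarrow> a < r \<and> b < r"
    if "i \<in> K" for i
    using subsetD[OF K that] by (auto simp: basis_idx_def)
  have "m = 0"
    by (rule cyc_ideal_low[OF \<open>m \<in> cyc_ideal\<close>]; drule ex, erule bexE, drule idx)
       (simp_all add: p degree_cyc_poly)
  then have "0 = Poly_Mapping.lookup m (basis_idx i)" by simp
  also have "\<dots> = (\<Sum>j\<in>K. if j = i then k j else 0)"
    unfolding lookup using inj_basis_idx by (intro sum.cong) (auto simp: inj_eq)
  also have "\<dots> = k i" using assms(2,5) by simp
  finally show ?thesis by simp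
qed

section \<open>Passage to classes and the four equivalences\<close>

lemma dcbmw_class_power:
  "dcbmw_class r \<omega> u f [^]\<^bsub>dcbmw r \<omega> u\<^esub> (n::nat) = dcbmw_class r \<omega> u (f ^ n)"
proof -
  interpret ring "dcbmw r \<omega> u" by (rule ring_dcbmw)
  show ?thesis
    by (induction n) (simp_all add: dcbmw_simps power_commutes)
qed

lemma dcbmw_class_sum:
  assumes "finite K"
  shows "finsum (dcbmw r \<omega> u) (\<lambda>i. dcbmw_class r \<omega> u (f i)) K = dcbmw_class r \<omega> u (\<Sum>i\<in>K. f i)"
proof -
  interpret ring "dcbmw r \<omega> u" by (rule ring_dcbmw)
  have *: "dcbmw_class r \<omega> u g \<in> carrier (dcbmw r \<omega> u)" for g by (simp add: dcbmw_simps)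
  show ?thesis
    using assms
  proof (induction K)
    case empty show ?case by (simp add: dcbmw_simps)
  next
    case (insert i K)
    have "finsum (dcbmw r \<omega> u) (\<lambda>i. dcbmw_class r \<omega> u (f i)) (insert i K)
        = dcbmw_class r \<omega> u (f i) \<oplus>\<^bsub>dcbmw r \<omega> u\<^esub> finsum (dcbmw r \<omega> u) (\<lambda>i. dcbmw_class r \<omega> u (f i)) K"
      by (rule finsum_insert) (use insert * in auto)
    with insert show ?case by (simp add: dcbmw_simps)
  qed
qed

lemma lin_indep_family_dcbmw:
  "lin_indep_family (ring_of_type_algebra :: 'a::comm_ring_1 ring) (dcbmw r \<omega> u) (\<lambda>i. dcbmw_class r \<omega> u (v i)) I \<longleftrightarrow>
    (\<forall>K c. finite K \<longrightarrow> K \<subseteq> I \<longrightarrow> (\<Sum>i\<in>K. scalar (c i :: 'a) * v i) \<in> dcbmw_ideal r \<omega> u \<longrightarrow> (\<forall>i\<in>K. c i = 0))"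
proof -
  have "finsum (dcbmw r \<omega> u) (\<lambda>i. c i \<odot>\<^bsub>dcbmw r \<omega> u\<^esub> dcbmw_class r \<omega> u (v i)) K = \<zero>\<^bsub>dcbmw r \<omega> u\<^esub> \<longleftrightarrow>
      (\<Sum>i\<in>K. scalar (c i :: 'a) * v i) \<in> dcbmw_ideal r \<omega> u" if "finite K" for K c
    using that by (simp add: dcbmw_simps dcbmw_class_sum dcbmw_class_eq_iff)
  then show ?thesis
    unfolding lin_indep_family_def by auto
qed

theorem theorem5p2:
  fixes r :: nat and \<omega> u :: "nat \<Rightarrow> 'a::comm_ring_1"
  assumes "(2::'a) dvd 1" and "r \<ge> 1"
  defines "R \<equiv> (ring_of_type_algebra :: 'a ring)"
    and "W \<equiv> dcbmw r \<omega> u"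
    and "s1 \<equiv> dcbmw_class r \<omega> u (gen S1)"
    and "e1 \<equiv> dcbmw_class r \<omega> u (gen E1)"
    and "x1 \<equiv> dcbmw_class r \<omega> u (gen X1)"
    and "x2 \<equiv> dcbmw_class r \<omega> u (gen X2)"
    and "D \<equiv> {0..r - 1} \<times> {0..r - 1}"
  defines "cond1 \<equiv> lin_indep_family R W (\<lambda>a. x1 [^]\<^bsub>W\<^esub> a \<otimes>\<^bsub>W\<^esub> e1) {0..r - 1}"
    and "cond2 \<equiv> lin_indep_family R W
      (case_sum (\<lambda>(a, b). x1 [^]\<^bsub>W\<^esub> a \<otimes>\<^bsub>W\<^esub> e1 \<otimes>\<^bsub>W\<^esub> x1 [^]\<^bsub>W\<^esub> b)
        (case_sum (\<lambda>(a, b). x1 [^]\<^bsub>W\<^esub> a \<otimes>\<^bsub>W\<^esub> x2 [^]\<^bsub>W\<^esub> b \<otimes>\<^bsub>W\<^esub> s1)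
          (\<lambda>(a, b). x1 [^]\<^bsub>W\<^esub> a \<otimes>\<^bsub>W\<^esub> x2 [^]\<^bsub>W\<^esub> b)))
      (D <+> D <+> D)"
    and "cond3 \<equiv> admissible r \<omega> u"
    and "cond4 \<equiv> u_admissible r \<omega> u"
  shows "(cond1 \<longleftrightarrow> cond2) \<and> (cond2 \<longleftrightarrow> cond3) \<and> (cond3 \<longleftrightarrow> cond4)"
proof -
  let ?J = "dcbmw_ideal r \<omega> u"
  have c1: "cond1 \<longleftrightarrow> (\<forall>K c. finite K \<longrightarrow> K \<subseteq> {0..r - 1} \<longrightarrow>
      (\<Sum>a\<in>K. scalar (c a) * (gX ^ a * gE)) \<in> ?J \<longrightarrow> (\<forall>a\<in>K. c a = 0))"
    unfolding cond1_def R_def W_def x1_def e1_def dcbmw_class_power dcbmw_simps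
    by (rule lin_indep_family_dcbmw)
  have fam: "case_sum (\<lambda>(a, b). x1 [^]\<^bsub>W\<^esub> a \<otimes>\<^bsub>W\<^esub> e1 \<otimes>\<^bsub>W\<^esub> x1 [^]\<^bsub>W\<^esub> b)
        (case_sum (\<lambda>(a, b). x1 [^]\<^bsub>W\<^esub> a \<otimes>\<^bsub>W\<^esub> x2 [^]\<^bsub>W\<^esub> b \<otimes>\<^bsub>W\<^esub> s1)
          (\<lambda>(a, b). x1 [^]\<^bsub>W\<^esub> a \<otimes>\<^bsub>W\<^esub> x2 [^]\<^bsub>W\<^esub> b)) = (\<lambda>i. dcbmw_class r \<omega> u (basis_elt i))"
    unfolding W_def x1_def x2_def e1_def s1_def dcbmw_class_power dcbmw_simps
    by (auto simp: fun_eq_iff basis_elt_def split: sum.split)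
  have c2: "cond2 \<longleftrightarrow> (\<forall>K c. finite K \<longrightarrow> K \<subseteq> D <+> D <+> D \<longrightarrow>
      (\<Sum>i\<in>K. scalar (c i) * basis_elt i) \<in> ?J \<longrightarrow> (\<forall>i\<in>K. c i = 0))"
    unfolding cond2_def fam unfolding R_def W_def by (rule lin_indep_family_dcbmw)
  have "cond1" if cond2
    unfolding c1
  proof (intro allI impI)
    fix K and c :: "nat \<Rightarrow> 'a"
    assume K: "finite K" "K \<subseteq> {0..r - 1}" "(\<Sum>a\<in>K. scalar (c a) * (gX ^ a * gE)) \<in> ?J"
    \<comment> \<open>The first family consists of the elements x1^a e1 x1^0 of the second.\<close>
    let ?f = "\<lambda>a. Inl (a, 0) :: nat \<times> nat + nat \<times> nat + nat \<times> nat"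
    let ?c = "case_sum (\<lambda>(a, b). c a) (\<lambda>_. 0)"
    have indep: "\<And>K c. finite K \<Longrightarrow> K \<subseteq> D <+> D <+> D \<Longrightarrow>
        (\<Sum>i\<in>K. scalar (c i) * basis_elt i) \<in> ?J \<Longrightarrow> \<forall>i\<in>K. c i = 0"
      using that unfolding c2 by blast
    have sum: "(\<Sum>i\<in>?f ` K. scalar (?c i) * basis_elt i) = (\<Sum>a\<in>K. scalar (c a) * (gX ^ a * gE))"
      by (subst sum.reindex) (auto simp: inj_on_def basis_elt_def)
    have "\<forall>i\<in>?f ` K. ?c i = 0"
    proof (rule indep)
      show "(\<Sum>i\<in>?f ` K. scalar (?c i) * basis_elt i) \<in> ?J" unfolding sum by (rule K(3))
    qed (use K in \<open>auto simp: D_def\<close>)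
    then show "\<forall>a\<in>K. c a = 0" by auto
  qed
  moreover have cond3 if cond1
    unfolding cond3_def
  proof (rule admissible_if_indep[OF assms(2)])
    fix P :: "'a poly"
    assume P: "\<And>j. j \<ge> r \<Longrightarrow> coeff P j = 0" "ev P * gE \<in> ?J"
    have "degree P \<le> r - 1" by (rule degree_le) (use P(1) in auto)
    then have "ev P = (\<Sum>a\<le>r - 1. scalar (coeff P a) * gX ^ a)"
      unfolding ev_def by (rule fa.plin_superset)
    then have sum: "(\<Sum>a\<in>{0..r - 1}. scalar (coeff P a) * (gX ^ a * gE)) = ev P * gE"
      by (simp add: sum_distrib_right mult.assoc atMost_atLeast0)
    have indep: "\<And>c. (\<Sum>a\<in>{0..r - 1}. scalar (c a) * (gX ^ a * gE)) \<in> ?J \<Longrightarrow> \<forall>a\<in>{0..r - 1}. c a = 0"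
      using that unfolding c1 by blast
    have low: "\<forall>a\<in>{0..r - 1}. coeff P a = 0"
      by (rule indep) (simp only: sum P(2))
    show "P = 0"
    proof (rule poly_eqI)
      fix j
      show "coeff P j = coeff 0 j"
        using low P(1)[of j] assms(2) by (cases "j < r") auto
    qed
  qed
  moreover have eq34: "cond3 \<longleftrightarrow> cond4"
    unfolding cond3_def cond4_def by (rule admissible_iff_u_admissible[OF assms(1,2)])
  moreover have cond2 if cond3
  proof -
    \<comment> \<open>Admissibility supplies \<open>sigma_p\<close> and \<open>omega_p\<close>; the
      quadratic relations are reached through u-admissibility.\<close>
    from that eq34 have "u_admissible r \<omega> u" by (simp add: cond4_def)
    interpret cyc_params \<omega> "cyc_poly r u" "(-1) ^ r"
      using that omega_sig_u_admissible[OF assms(1) \<open>u_admissible r \<omega> u\<close>] assms(1)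
      unfolding cond3_def admissible_iff[OF assms(2)] by unfold_locales (auto simp: monic_cyc_poly)
    have "D = {0..<r} \<times> {0..<r}" using assms(2) by (auto simp: D_def)
    then show ?thesis
      unfolding c2 using basis_elt_indep[OF refl] by blast
  qed
  ultimately show ?thesis by blast
qed

end
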